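(* Let $G_i$, $1\le i\le t$, be a finite family of groups each of which is (isomorphic to) the automorphism group of a directed rooted tree. (1) For every positive integer $s$, the wreath product $$\Bigl(\prod_{i=1}^tG_i\Bigr)\wr\mathbb{Z}/s,$$ with $\mathbb{Z}/s$ acting cyclically on a set of size $s$, is isomorphic to $\mathrm{Aut}(f)$ for some connected function $f:X\to X$ having a finite orbit, whose unique cyclic orbit has size $st$. (2) The wreath product $$\Bigl(\prod_{i=1}^tG_i\Bigr)\wr\mathbb{Z},$$ with $\mathbb{Z}$ acting on itself by translations, is isomorphic to $\mathrm{Aut}(f)$ for some connected function $f:X\to X$ which has no finite orbits and for which some element of $\mathrm{Aut}(f)$ fixes no points of $X$.
   Context: $\Sigma_X$ is the group of all permutations of $X$. For $f:X\to X$, $\mathrm{Aut}(f)=\{\sigma\in\Sigma_X:\sigma\circ f=f\circ\sigma\}$. A function $f:X\to X$ is connected if for all $x,y\in X$ there are non-negative integers $m,n$ with $f^m(x)=f^n(y)$. Orbits are forward orbits $\{x,f(x),f^2(x),\dots\}$; a cyclic orbit is one of the form $x,f(x),\dots,f^{n-1}(x),f^n(x)=x$. A directed rooted tree is a directed tree with a distinguished vertex, the root, such that all edges are oriented towards the root; its automorphism group is its group of digraph automorphisms. If a group $H$ acts on a set $\Omega$, the wreath product $G\wr H$ is the unrestricted one, $G^\Omega\rtimes H$ with $H$ permuting the coordinates. *)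

theory Defs
  imports
    "HOL-Algebra.Bij"
    "HOL-Algebra.Product_Groups"
    "HOL-Algebra.Elementary_Groups"
    "Graph_Theory.Graph_Theory"
begin

section \<open>Self-maps of a set\<close>

text \<open>
  A function \<open>f : X \<rightarrow> X\<close> is a HOL function with \<open>f \<in> X \<rightarrow> X\<close>; its values outside \<open>X\<close> play no role.
\<close>

definition fun_Aut :: "'x set \<Rightarrow> ('x \<Rightarrow> 'x) \<Rightarrow> ('x \<Rightarrow> 'x) monoid" where
  "fun_Aut X f = (BijGroup X)
     \<lparr>carrier := {\<sigma> \<in> carrier (BijGroup X). \<forall>x\<in>X. \<sigma> (f x) = f (\<sigma> x)}\<rparr>"

definition connected_fun :: "'x set \<Rightarrow> ('x \<Rightarrow> 'x) \<Rightarrow> bool" where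
  "connected_fun X f \<longleftrightarrow> (\<forall>x\<in>X. \<forall>y\<in>X. \<exists>m n. (f ^^ m) x = (f ^^ n) y)"

text \<open>
  Unlike \<^const>\<open>Orbits.orbit\<close>, the forward orbit of \<open>x\<close> always contains \<open>x\<close> itself.
\<close>

definition forward_orbit :: "('x \<Rightarrow> 'x) \<Rightarrow> 'x \<Rightarrow> 'x set" where
  "forward_orbit f x = {(f ^^ n) x | n. True}"

definition cyclic_orbit :: "'x set \<Rightarrow> ('x \<Rightarrow> 'x) \<Rightarrow> 'x set \<Rightarrow> bool" where
  "cyclic_orbit X f C \<longleftrightarrow>
     (\<exists>x\<in>X. C = forward_orbit f x \<and> (\<exists>n>0. (f ^^ n) x = x))"


section \<open>Directed rooted trees\<close>

text \<open>
  Trees may be infinite. The library predicates \<open>forest\<close> and \<open>tree\<close> only exclude directed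
  cycles, so acyclicity of the underlying undirected graph is stated here through its
  symmetric digraph \<^const>\<open>mk_symmetric\<close>, whose cycles of length at least 3 are exactly the
  undirected cycles. Asymmetry of the arc relation excludes loops and pairs of opposite arcs.
  The library predicate \<open>Digraph_Component.connected\<close> means weakly connected and nonempty.
\<close>

definition directed_tree :: "'v pair_pre_digraph \<Rightarrow> bool" where
  "directed_tree T \<longleftrightarrow>
     pair_wf_digraph T \<and> asym (parcs T) \<and>
     Digraph_Component.connected (with_proj T) \<and>
     \<not> (\<exists>p. pre_digraph.cycle (with_proj (mk_symmetric (with_proj T))) p \<and> length p \<ge> 3)"

text \<open>
  An arc \<open>(u, v)\<close> is oriented towards the root \<open>r\<close> if it is the first arc of the (unique) path
  from \<open>u\<close> to \<open>r\<close> in the underlying undirected tree.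
\<close>

definition directed_rooted_tree :: "'v pair_pre_digraph \<Rightarrow> 'v \<Rightarrow> bool" where
  "directed_rooted_tree T r \<longleftrightarrow>
     directed_tree T \<and> r \<in> pverts T \<and>
     (\<forall>(u, v) \<in> parcs T.
        \<exists>p. pre_digraph.apath (with_proj (mk_symmetric (with_proj T))) u ((u, v) # p) r)"

definition digraph_Aut :: "'v pair_pre_digraph \<Rightarrow> ('v \<Rightarrow> 'v) monoid" where
  "digraph_Aut T = (BijGroup (pverts T))
     \<lparr>carrier := {\<sigma> \<in> carrier (BijGroup (pverts T)).
        \<forall>u\<in>pverts T. \<forall>v\<in>pverts T. (u, v) \<in> parcs T \<longleftrightarrow> (\<sigma> u, \<sigma> v) \<in> parcs T}\<rparr>"


section \<open>Unrestricted wreath products\<close>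

definition semidirect_product ::
    "('n, 'c) monoid_scheme \<Rightarrow> ('h, 'd) monoid_scheme \<Rightarrow> ('h \<Rightarrow> 'n \<Rightarrow> 'n) \<Rightarrow> ('n \<times> 'h) monoid" where
  "semidirect_product N H \<theta> =
     \<lparr>carrier = carrier N \<times> carrier H,
      monoid.mult = (\<lambda>(a, h) (b, k). (a \<otimes>\<^bsub>N\<^esub> \<theta> h b, h \<otimes>\<^bsub>H\<^esub> k)),
      one = (\<one>\<^bsub>N\<^esub>, \<one>\<^bsub>H\<^esub>)\<rparr>"

text \<open>
  For a left action \<open>\<phi>\<close> of \<open>H\<close> on \<open>\<Omega>\<close>, the element \<open>h\<close> moves the coordinate at \<open>\<omega>\<close> to position
  \<open>\<phi> h \<omega>\<close>; hence the inverse in the formula.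
\<close>

definition wreath_product ::
    "('g, 'c) monoid_scheme \<Rightarrow> ('h, 'd) monoid_scheme \<Rightarrow> 'o set \<Rightarrow> ('h \<Rightarrow> 'o \<Rightarrow> 'o)
      \<Rightarrow> (('o \<Rightarrow> 'g) \<times> 'h) monoid" where
  "wreath_product G H \<Omega> \<phi> =
     semidirect_product (product_group \<Omega> (\<lambda>_. G)) H
       (\<lambda>h a. \<lambda>\<omega>\<in>\<Omega>. a (\<phi> (inv\<^bsub>H\<^esub> h) \<omega>))"

text \<open>
  For \<open>H = \<int>\<close> this is the action by translations on \<open>\<int>\<close>; for \<open>H = \<int>/s\<close> it is the action by
  \<open>x \<mapsto> (k + x) mod s\<close> on \<open>{0..<s}\<close>, in which the generator 1 acts as an \<open>s\<close>-cycle.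
\<close>

definition translation_action :: "('h, 'd) monoid_scheme \<Rightarrow> 'h \<Rightarrow> 'h \<Rightarrow> 'h" where
  "translation_action H h = (\<lambda>x\<in>carrier H. h \<otimes>\<^bsub>H\<^esub> x)"

end

theory Submission
  imports Defs "HOL-Library.Countable"
begin

text \<open>
  A tree with all arcs oriented towards its root \<open>r\<close> is the same thing as a self-map: send every
  vertex to its parent and \<open>r\<close> to itself. The digraph automorphisms are then the permutations
  commuting with that map (\<open>directed_rooted_tree_parent_map\<close>, \<open>digraph_Aut_eq_fun_Aut\<close>). So it is
  natural to realise the wreath product by a single self-map \<open>f\<close> that strings the trees together:
  take a copy of \<open>T\<^sub>1, \<dots>, T\<^sub>t\<close> for every element of \<open>\<int>/s\<close> (or of \<open>\<int>\<close>), let \<open>f\<close> be the parent map away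
  from the roots, and let it send the root of each copy to the root of the next one, where the
  successor of the copy of \<open>T\<^sub>t\<close> at \<open>j\<close> is the copy of \<open>T\<^sub>1\<close> at \<open>j + 1\<close>. Applying tree automorphisms
  independently in each copy and shifting by \<open>h\<close> gives an action of the wreath product.

  Two things could produce further automorphisms. If the \<open>T\<^sub>i\<close> are isomorphic to each other, the
  necklace can be rotated by a number of beads that is not a multiple of \<open>t\<close>. And if the necklace is
  infinite and the trees contain infinite backward rays, an automorphism need not map roots to
  roots. A rigid decoration excludes both: every vertex receives one extra leaf, except the roots
  of the copies of \<open>T\<^sub>1\<close>. The image of \<open>f\<close> then consists of exactly the tree vertices, because
  each of them is the image of its leaf or, if it is a root, of the preceding root. Hence an
  automorphism preserves the leaves, and also the \<open>bare\<close> points, which lie in the image and have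
  all their preimages in the image; these are exactly the roots of the copies of \<open>T\<^sub>1\<close>. As all roots are
  iterated images of those, automorphisms preserve the set of roots, act on the blocks by a map that
  commutes with the successor and preserves the set of copies of \<open>T\<^sub>1\<close>, which is a shift, and restrict
  to isomorphisms of the trees (\<open>automorphism_decompose\<close>, \<open>advance_symmetry_is_shift\<close>). The
  leaves follow the vertices that carry them, so the decoration costs no symmetry of the trees.

  The two parts are proved together: with \<open>s = 0\<close>, the group \<open>\<int>/s\<close> is \<open>\<int>\<close>, and reduction modulo \<open>0\<close> is
  the identity. The differences between them concern only the orbits of \<open>f\<close>.
\<close>

section \<open>Unique paths and parents in a directed rooted tree\<close>

text \<open>
  Paths and cycles are handled as lists of vertices here, since splitting and reversing lists is
  easier than splicing arc walks.
\<close>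

definition simple_path :: "('v \<Rightarrow> 'v \<Rightarrow> bool) \<Rightarrow> 'v list \<Rightarrow> bool" where
  "simple_path E xs \<longleftrightarrow> xs \<noteq> [] \<and> distinct xs \<and> successively E xs"

definition graph_cycle :: "('v \<Rightarrow> 'v \<Rightarrow> bool) \<Rightarrow> 'v list \<Rightarrow> bool" where
  "graph_cycle E xs \<longleftrightarrow> simple_path E xs \<and> length xs \<ge> 3 \<and> E (last xs) (hd xs)"

text \<open>
  Two paths from \<open>u\<close> that start differently but end at the same vertex meet again. Going along one
  of them to the first vertex \<open>x\<close> that lies on the other, and back along the other, gives a cycle.
\<close>

lemma simple_path_second_vertex_unique:
  assumes sym: "symp E"
    and acyclic: "\<nexists>xs. graph_cycle E xs"
    and p: "simple_path E (u # v # vs)" and q: "simple_path E (u # w # ws)"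
    and last: "last (v # vs) = last (w # ws)"
  shows "v = w"
proof (rule ccontr)
  assume "v \<noteq> w"
  have "\<exists>x\<in>set (v # vs). x \<in> set (w # ws)"
    using last last_in_set[of "v # vs"] last_in_set[of "w # ws"] by (metis list.distinct(1))
  then obtain as x bs where 1: "v # vs = as @ x # bs" "x \<in> set (w # ws)"
      and as: "\<forall>a\<in>set as. a \<notin> set (w # ws)"
    using split_list_first_prop[of "v # vs" "\<lambda>x. x \<in> set (w # ws)"] by blast
  from 1(2) obtain cs ds where 2: "w # ws = cs @ x # ds"
    by (meson split_list)
  have s1: "simple_path E (u # as @ x # bs)" and s2: "simple_path E (u # cs @ x # ds)"
    using p q unfolding 1(1)[symmetric] 2[symmetric] .
  let ?c = "u # as @ x # rev cs"
  have d: "distinct ?c"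
    using s1 s2 as unfolding 2 simple_path_def by auto
  \<comment> \<open>The cycle is cut into the way out, up to \<open>x\<close>, and the way back from \<open>x\<close> to \<open>u\<close>.\<close>
  have b1: "successively E ((u # as) @ [x])" 
    using s1 unfolding simple_path_def by (auto simp: successively_append_iff successively_Cons hd_append)
  have "successively E ((u # cs) @ [x])" 
    using s2 unfolding simple_path_def by (auto simp: successively_append_iff successively_Cons hd_append)
  then have "successively (\<lambda>x y. E y x) (rev ((u # cs) @ [x]))"
    by (simp only: successively_rev)
  then have b2: "successively E (x # rev cs @ [u])"
    using sym by (auto simp: symp_def elim!: successively_mono)
  then have b3: "successively E ((x # rev cs) @ [u])" by simp
  have "successively E ((u # as) @ (x # rev cs))"
    using b1 b3 unfolding successively_append_iff by (auto simp: successively_append_iff)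
  moreover have "E (last ?c) (hd ?c)"
    using b3 unfolding successively_append_iff by auto
  moreover have "length ?c \<ge> 3"
  proof (rule ccontr)
    assume "\<not> length ?c \<ge> 3"
    then have "as = []" "cs = []" by (auto simp: not_le)
    then show False using 1 2 \<open>v \<noteq> w\<close> by auto
  qed
  ultimately have "graph_cycle E ?c"
    using d unfolding graph_cycle_def simple_path_def by auto
  with acyclic show False by blast
qed

abbreviation underlying_graph :: "'v pair_pre_digraph \<Rightarrow> ('v, 'v \<times> 'v) pre_digraph" where
  "underlying_graph T \<equiv> with_proj (mk_symmetric (with_proj T))"

definition adjacent :: "'v pair_pre_digraph \<Rightarrow> 'v \<Rightarrow> 'v \<Rightarrow> bool" where
  "adjacent T u v \<longleftrightarrow> (u, v) \<in> parcs T \<or> (v, u) \<in> parcs T"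

lemma parcs_underlying: "(u, v) \<in> parcs (mk_symmetric (with_proj T)) \<longleftrightarrow> adjacent T u v"
  by (auto simp: parcs_mk_symmetric adjacent_def Bex_def split_paired_Ex)

lemma symp_adjacent: "symp (adjacent T)"
  by (auto simp: symp_def adjacent_def)

lemma awalk_successively:
  assumes "pcas u p v" "set p \<subseteq> parcs (mk_symmetric (with_proj T))"
  shows "successively (adjacent T) (pawalk_verts u p) \<and> hd (pawalk_verts u p) = u
    \<and> last (pawalk_verts u p) = v \<and> pawalk_verts u p \<noteq> []"
  using assms
proof (induction p arbitrary: u)
  case (Cons e p)
  then have "successively (adjacent T) (pawalk_verts (snd e) p) \<and> hd (pawalk_verts (snd e) p) = snd e
    \<and> last (pawalk_verts (snd e) p) = v \<and> pawalk_verts (snd e) p \<noteq> []"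
    by auto
  moreover have "adjacent T (fst e) (snd e)"
    using Cons.prems(2) by (auto simp flip: parcs_underlying)
  ultimately show ?case using Cons.prems(1) by (auto simp: successively_Cons)
qed auto

lemma apath_simple_path:
  assumes "pre_digraph.apath (underlying_graph T) u p v"
  shows "simple_path (adjacent T) (pawalk_verts u p)"
    and "hd (pawalk_verts u p) = u" and "last (pawalk_verts u p) = v"
  using assms awalk_successively[of u p v T]
  unfolding pre_digraph.apath_def pre_digraph.awalk_def simple_path_def
    cas_with_proj_eq awalk_verts_with_proj_eq by auto

lemma successively_awalk:
  assumes "successively (adjacent T) (u # ys)"
  shows "pcas u (zip (u # ys) ys) (last (u # ys))"
    and "set (zip (u # ys) ys) \<subseteq> parcs (mk_symmetric (with_proj T))"
    and "pawalk_verts u (zip (u # ys) ys) = u # ys"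
  using assms
proof (induction ys arbitrary: u)
  case (Cons y ys)
  {
    case 1
    then show ?case using Cons.IH(1)[of y] by auto
  next
    case 2
    then show ?case using Cons.IH(2)[of y] by (auto simp: parcs_underlying)
  next
    case 3
    then show ?case using Cons.IH(3)[of y] by auto
  }
qed auto

lemma cycle_if_graph_cycle:
  assumes wf: "pair_wf_digraph T" and "graph_cycle (adjacent T) xs"
  shows "\<exists>p. pre_digraph.cycle (underlying_graph T) p \<and> length p \<ge> 3"
proof -
  obtain u ys where xs: "xs = u # ys"
    using assms(2) by (cases xs) (auto simp: graph_cycle_def)
  let ?zs = "ys @ [u]"
  have "successively (adjacent T) ((u # ys) @ [u])"
    using assms(2) unfolding xs graph_cycle_def simple_path_def successively_append_iff by auto
  then have s: "successively (adjacent T) (u # ?zs)" by simp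
  have "successively (adjacent T) (u # ys)" "ys \<noteq> []" using assms(2) unfolding xs graph_cycle_def simple_path_def by auto
  then have "adjacent T u (hd ys)" by (auto simp: successively_Cons)
  then have "u \<in> pverts T"
    using wf by (auto simp: adjacent_def pair_wf_digraph_def)
  then have "pre_digraph.cycle (underlying_graph T) (zip (u # ?zs) ?zs)"
    unfolding pre_digraph.cycle_def pre_digraph.awalk_def cas_with_proj_eq awalk_verts_with_proj_eq
    using successively_awalk[OF s] assms(2)
    by (intro exI[of _ u]) (auto simp: graph_cycle_def simple_path_def xs)
  moreover have "length (zip (u # ?zs) ?zs) \<ge> 3"
    using assms(2) by (auto simp: graph_cycle_def xs)
  ultimately show ?thesis by blast
qed

text \<open>
  Trees are encoded by parent maps; letting the root be its own parent keeps the map total, so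
  that commuting with it can replace preservation of arcs.
\<close>

definition rooted_map :: "'v set \<Rightarrow> ('v \<Rightarrow> 'v) \<Rightarrow> 'v \<Rightarrow> bool" where
  "rooted_map V p r \<longleftrightarrow> r \<in> V \<and> p \<in> V \<rightarrow> V \<and> p r = r \<and> (\<forall>v\<in>V. \<exists>n. (p ^^ n) v = r)"

lemma rooted_map_fixpoint_unique:
  assumes "rooted_map V p r" "v \<in> V" "p v = v"
  shows "v = r"
proof -
  obtain n where n: "(p ^^ n) v = r" using assms by (auto simp: rooted_map_def)
  have "(p ^^ n) v = v" using assms(3) by (induction n) auto
  with n show ?thesis by simp
qed

text \<open>
  Every arc \<open>(u, v)\<close> begins a path to the root, so by uniqueness of paths \<open>u\<close> has no other outgoing
  arc. Conversely, on a path in the underlying graph to the root every edge points forwards: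
  if \<open>(v, u)\<close> were an arc although \<open>v\<close> follows \<open>u\<close>, then the path that starts with this arc and the
  rest of the given path would leave \<open>v\<close> in different directions.
\<close>

theorem directed_rooted_tree_parent_map:
  assumes T: "directed_rooted_tree T r"
  obtains p where "rooted_map (pverts T) p r"
    and "\<And>u v. u \<in> pverts T \<Longrightarrow> v \<in> pverts T \<Longrightarrow> (u, v) \<in> parcs T \<longleftrightarrow> u \<noteq> r \<and> v = p u"
proof -
  let ?E = "adjacent T"
  have wf: "pair_wf_digraph T" and r: "r \<in> pverts T"
    and conn: "Digraph_Component.connected (with_proj T)"
    using T by (auto simp: directed_rooted_tree_def directed_tree_def)
  have acyclic: "\<nexists>xs. graph_cycle ?E xs"
    using T cycle_if_graph_cycle[OF wf] by (auto simp: directed_rooted_tree_def directed_tree_def)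
  note unique = simple_path_second_vertex_unique[OF symp_adjacent acyclic]
  have arc_path: "\<exists>zs. simple_path ?E (u # v # zs) \<and> last (v # zs) = r" if arc: "(u, v) \<in> parcs T" for u v
  proof -
    obtain p where p: "pre_digraph.apath (underlying_graph T) u ((u, v) # p) r"
      using T arc by (auto simp: directed_rooted_tree_def)
    have "pre_digraph.cas (underlying_graph T) v p r"
      using p by (auto simp: pre_digraph.apath_def pre_digraph.awalk_def pre_digraph.cas.simps)
    then have "pcas v p r" by (simp add: cas_with_proj_eq)
    then have "pawalk_verts v p = v # tl (pawalk_verts v p)"
      by (cases p) auto
    then show ?thesis
      using apath_simple_path[OF p] by (metis fst_conv last_ConsR list.distinct(1) pawalk_verts.simps(2) snd_conv)
  qed
  have root_sink: "(r, v) \<notin> parcs T" for v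
  proof
    assume "(r, v) \<in> parcs T"
    then obtain zs where "simple_path ?E (r # v # zs)" "last (v # zs) = r"
      using arc_path by blast
    then show False
      using last_in_set[of "v # zs"] by (auto simp: simple_path_def)
  qed
  have arc_unique: "v = w" if "(u, v) \<in> parcs T" "(u, w) \<in> parcs T" for u v w
    using arc_path[OF that(1)] arc_path[OF that(2)] unique by metis
  have path_arc: "(u, v) \<in> parcs T"
    if path: "simple_path ?E (u # v # zs)" and last: "last (v # zs) = r" for u v zs
  proof (rule ccontr)
    assume "(u, v) \<notin> parcs T"
    then have "(v, u) \<in> parcs T"
      using path by (auto simp: simple_path_def adjacent_def)
    then obtain ws where ws: "simple_path ?E (v # u # ws)" "last (u # ws) = r"
      using arc_path by blast
    show False
    proof (cases zs)
      case Nil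
      then show False using last \<open>(v, u) \<in> parcs T\<close> root_sink by auto
    next
      case (Cons z zs')
      then have "simple_path ?E (v # z # zs')" "last (z # zs') = r"
        using path last by (auto simp: simple_path_def)
      then have "z = u"
        using unique ws by metis
      then show False using path Cons by (auto simp: simple_path_def)
    qed
  qed
  have path_to_root: "\<exists>zs. simple_path ?E (u # zs) \<and> last (u # zs) = r" if u: "u \<in> pverts T" for u
  proof -
    interpret S: pair_wf_digraph "mk_symmetric (with_proj T)"
      using wf by (intro wf_digraph.wellformed_mk_symmetric) (simp add: wf_digraph_wp_iff)
    have "u \<rightarrow>\<^sup>*\<^bsub>underlying_graph T\<^esub> r"
      using conn u r unfolding connected_def strongly_connected_def by simp
    then obtain p where p: "S.apath u p r"
      using S.reachable_apath by blast
    then have "pcas u p r" by (auto simp: S.apath_def S.awalk_def)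
    then have "pawalk_verts u p = u # tl (pawalk_verts u p)"
      by (cases p) auto
    with apath_simple_path[OF p] show ?thesis by metis
  qed
  define p where "p u = (if \<exists>v. (u, v) \<in> parcs T then (SOME v. (u, v) \<in> parcs T) else r)" for u
  have p_arc: "p u = v" if "(u, v) \<in> parcs T" for u v
    using that arc_unique someI[of "\<lambda>v. (u, v) \<in> parcs T" v] unfolding p_def by auto
  have p_root: "p r = r" using root_sink by (simp add: p_def)
  have reach: "simple_path ?E (u # zs) \<Longrightarrow> last (u # zs) = r \<Longrightarrow> \<exists>n. (p ^^ n) u = r" for u zs
  proof (induction zs arbitrary: u)
    case Nil
    then show ?case by (intro exI[of _ 0]) auto
  next
    case (Cons v zs)
    have "simple_path ?E (v # zs)" "last (v # zs) = r" using Cons.prems by (auto simp: simple_path_def)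
    then obtain n where "(p ^^ n) v = r" using Cons.IH by blast
    moreover have "p u = v"
      using path_arc Cons.prems p_arc by auto
    ultimately show ?case by (intro exI[of _ "Suc n"]) (simp add: funpow_swap1)
  qed
  have out: "\<exists>v. (u, v) \<in> parcs T" if u: "u \<in> pverts T" "u \<noteq> r" for u
  proof -
    obtain zs where zs: "simple_path ?E (u # zs)" "last (u # zs) = r"
      using path_to_root u by blast
    then obtain v vs where "zs = v # vs" using u by (cases zs) auto
    then show ?thesis using path_arc zs by auto
  qed
  have "p u \<in> pverts T" for u
  proof (cases "\<exists>v. (u, v) \<in> parcs T")
    case True
    then obtain v where v: "(u, v) \<in> parcs T" by blast
    then have "v \<in> pverts T" using wf by (auto simp: pair_wf_digraph_def)
    then show ?thesis using p_arc[OF v] by simp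
  qed (simp add: p_def r)
  then have "rooted_map (pverts T) p r"
    unfolding rooted_map_def using r p_root path_to_root reach by blast
  moreover have "(u, v) \<in> parcs T \<longleftrightarrow> u \<noteq> r \<and> v = p u" if "u \<in> pverts T" for u v
    using out[OF that] p_arc root_sink by blast
  ultimately show thesis using that by blast
qed

text \<open>
  The root is the only vertex without an outgoing arc and also the only fixed point of \<open>p\<close>, so
  permutations of either kind fix it; elsewhere the arc \<open>(u, p u)\<close> determines \<open>p u\<close>.
\<close>

lemma digraph_Aut_eq_fun_Aut:
  assumes p: "rooted_map (pverts T) p r"
    and arcs: "\<And>u v. u \<in> pverts T \<Longrightarrow> v \<in> pverts T \<Longrightarrow> (u, v) \<in> parcs T \<longleftrightarrow> u \<noteq> r \<and> v = p u"
  shows "digraph_Aut T = fun_Aut (pverts T) p"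
proof -
  let ?V = "pverts T"
  have r: "r \<in> ?V" and pV: "\<And>u. u \<in> ?V \<Longrightarrow> p u \<in> ?V" and pr: "p r = r"
    using p by (auto simp: rooted_map_def)
  have "(\<forall>u\<in>?V. \<forall>v\<in>?V. (u, v) \<in> parcs T \<longleftrightarrow> (\<sigma> u, \<sigma> v) \<in> parcs T) \<longleftrightarrow> (\<forall>u\<in>?V. \<sigma> (p u) = p (\<sigma> u))"
    (is "?L \<longleftrightarrow> ?R") if bij: "bij_betw \<sigma> ?V ?V" for \<sigma>
  proof -
    have \<sigma>V: "\<sigma> u \<in> ?V" if "u \<in> ?V" for u using bij that by (auto simp: bij_betw_def)
    have inj: "\<sigma> u = \<sigma> v \<longleftrightarrow> u = v" if "u \<in> ?V" "v \<in> ?V" for u v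
      using bij that by (auto simp: bij_betw_def inj_on_def)
    show ?thesis
    proof
      assume L: ?L
      have root: "\<sigma> r = r"
      proof (rule ccontr)
        assume "\<sigma> r \<noteq> r"
        then have arc: "(\<sigma> r, p (\<sigma> r)) \<in> parcs T"
          using arcs \<sigma>V pV r by blast
        obtain v where "v \<in> ?V" "\<sigma> v = p (\<sigma> r)"
          using bij pV[OF \<sigma>V[OF r]] by (metis bij_betw_def imageE)
        then show False using L r arc arcs by metis
      qed
      show ?R
      proof
        fix u assume u: "u \<in> ?V"
        show "\<sigma> (p u) = p (\<sigma> u)"
        proof (cases "u = r")
          case False
          then have "(\<sigma> u, \<sigma> (p u)) \<in> parcs T" using L u pV arcs by blast
          then show ?thesis using arcs \<sigma>V pV u by blast
        qed (simp add: root pr)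
      qed
    next
      assume R: ?R
      then have "p (\<sigma> r) = \<sigma> r" using r pr by force
      then have root: "\<sigma> r = r" using rooted_map_fixpoint_unique[OF p] \<sigma>V r by blast
      show ?L
      proof (intro ballI)
        fix u v assume uv: "u \<in> ?V" "v \<in> ?V"
        have "\<sigma> u \<noteq> r \<longleftrightarrow> u \<noteq> r" using inj[OF uv(1) r] root by auto
        moreover have "\<sigma> v = p (\<sigma> u) \<longleftrightarrow> v = p u" using R uv inj pV by metis
        ultimately show "(u, v) \<in> parcs T \<longleftrightarrow> (\<sigma> u, \<sigma> v) \<in> parcs T"
          using arcs uv \<sigma>V by blast
      qed
    qed
  qed
  then have "{\<sigma> \<in> Bij ?V. \<forall>u\<in>?V. \<forall>v\<in>?V. (u, v) \<in> parcs T \<longleftrightarrow> (\<sigma> u, \<sigma> v) \<in> parcs T}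
    = {\<sigma> \<in> Bij ?V. \<forall>u\<in>?V. \<sigma> (p u) = p (\<sigma> u)}"
    unfolding Bij_def by blast
  then show ?thesis
    unfolding digraph_Aut_def fun_Aut_def by (simp add: BijGroup_def)
qed

section \<open>Permutations commuting with a self-map\<close>

definition commuting_perm :: "'x set \<Rightarrow> ('x \<Rightarrow> 'x) \<Rightarrow> ('x \<Rightarrow> 'x) \<Rightarrow> bool" where
  "commuting_perm X f \<sigma> \<longleftrightarrow> bij_betw \<sigma> X X \<and> (\<forall>x\<in>X. \<sigma> (f x) = f (\<sigma> x))"

lemma carrier_fun_Aut: "carrier (fun_Aut X f) = {\<sigma> \<in> extensional X. commuting_perm X f \<sigma>}"
  by (auto simp: fun_Aut_def BijGroup_def Bij_def commuting_perm_def)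

lemma mult_fun_Aut:
  assumes "\<sigma> \<in> carrier (fun_Aut X f)" "\<tau> \<in> carrier (fun_Aut X f)"
  shows "\<sigma> \<otimes>\<^bsub>fun_Aut X f\<^esub> \<tau> = compose X \<sigma> \<tau>"
  using assms by (auto simp: fun_Aut_def BijGroup_def)

lemma commuting_perm_funpow:
  assumes "commuting_perm X f \<sigma>" "f \<in> X \<rightarrow> X" "x \<in> X"
  shows "\<sigma> ((f ^^ n) x) = (f ^^ n) (\<sigma> x)"
proof -
  have "(f ^^ n) x \<in> X" for n using assms by (induction n) auto
  then show ?thesis using assms by (induction n) (auto simp: commuting_perm_def)
qed

lemma commuting_perm_inv:
  assumes \<sigma>: "commuting_perm X f \<sigma>" and f: "f \<in> X \<rightarrow> X"
  shows "commuting_perm X f (inv_into X \<sigma>)"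
proof -
  have bij: "bij_betw \<sigma> X X" using \<sigma> by (simp add: commuting_perm_def)
  have "inv_into X \<sigma> (f x) = f (inv_into X \<sigma> x)" if x: "x \<in> X" for x
  proof -
    define y where "y = inv_into X \<sigma> x"
    have y: "y \<in> X" "x = \<sigma> y"
      using bij x unfolding y_def by (auto simp: bij_betw_def inv_into_into f_inv_into_f)
    then have "f x = \<sigma> (f y)" using \<sigma> by (simp add: commuting_perm_def)
    moreover have "f y \<in> X" using f y by auto
    ultimately show ?thesis
      using bij y by (auto simp: bij_betw_def)
  qed
  then show ?thesis using bij by (simp add: commuting_perm_def bij_betw_inv_into)
qed

lemma commuting_perm_image_iff:
  assumes \<sigma>: "commuting_perm X f \<sigma>" and f: "f \<in> X \<rightarrow> X" and x: "x \<in> X"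
  shows "\<sigma> x \<in> f ` X \<longleftrightarrow> x \<in> f ` X"
proof -
  have fwd: "\<tau> y \<in> f ` X" if "commuting_perm X f \<tau>" "y \<in> f ` X" for \<tau> y
  proof -
    obtain z where z: "z \<in> X" "y = f z" using \<open>y \<in> f ` X\<close> by blast
    then have "\<tau> y = f (\<tau> z)" "\<tau> z \<in> X"
      using that(1) by (auto simp: commuting_perm_def bij_betw_def)
    then show ?thesis by blast
  qed
  have "inv_into X \<sigma> (\<sigma> x) = x"
    using \<sigma> x by (auto simp: commuting_perm_def bij_betw_def)
  then show ?thesis
    using fwd[OF \<sigma>] fwd[OF commuting_perm_inv[OF \<sigma> f]] by metis
qed

text \<open>
  Being bare is defined from \<open>f\<close> alone, so it is invariant under all automorphisms; in the
  decorated necklace it singles out the roots that carry no leaf.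
\<close>

definition bare_point :: "'x set \<Rightarrow> ('x \<Rightarrow> 'x) \<Rightarrow> 'x \<Rightarrow> bool" where
  "bare_point X f x \<longleftrightarrow> x \<in> f ` X \<and> (\<forall>y\<in>X. f y = x \<longrightarrow> y \<in> f ` X)"

lemma commuting_perm_bare_point:
  assumes \<sigma>: "commuting_perm X f \<sigma>" and f: "f \<in> X \<rightarrow> X" and x: "x \<in> X" and bare: "bare_point X f x"
  shows "bare_point X f (\<sigma> x)"
  unfolding bare_point_def
proof (intro conjI ballI impI)
  show "\<sigma> x \<in> f ` X" using commuting_perm_image_iff[OF \<sigma> f x] bare by (simp add: bare_point_def)
  fix y assume y: "y \<in> X" "f y = \<sigma> x"
  obtain z where z: "z \<in> X" "y = \<sigma> z"
    using \<sigma> y(1) by (auto simp: commuting_perm_def bij_betw_def)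
  then have "\<sigma> (f z) = \<sigma> x" using y \<sigma> by (simp add: commuting_perm_def)
  moreover have "f z \<in> X" using f z by auto
  ultimately have "f z = x" using \<sigma> x by (auto simp: commuting_perm_def bij_betw_def inj_on_def)
  then show "y \<in> f ` X"
    using bare z commuting_perm_image_iff[OF \<sigma> f z(1)] by (simp add: bare_point_def)
qed

section \<open>Trees strung along a permutation of blocks\<close>

text \<open>
  The blocks \<open>b \<in> B\<close> carry the trees \<open>(V b, p b, r b)\<close>, and \<open>M\<close> is the set of blocks whose root carries
  no leaf. That every block is reached from \<open>M\<close> makes the set of roots recognisable.
\<close>

locale necklace =
  fixes B :: "'b :: countable set" and nxt :: "'b \<Rightarrow> 'b" and M :: "'b set"
    and V :: "'b \<Rightarrow> 'v set" and p :: "'b \<Rightarrow> 'v \<Rightarrow> 'v" and r :: "'b \<Rightarrow> 'v"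
  assumes nxt_bij: "bij_betw nxt B B"
    and M_sub: "M \<subseteq> B"
    and M_reach: "\<And>b. b \<in> B \<Longrightarrow> \<exists>m\<in>M. \<exists>n. (nxt ^^ n) m = b"
    and tree: "\<And>b. b \<in> B \<Longrightarrow> rooted_map (V b) (p b) (r b)"
begin

text \<open>
  The point \<open>pt v b False\<close> is the vertex \<open>v\<close> in block \<open>b\<close>, and \<open>pt v b True\<close> is the leaf attached to it.
  Block and flag are encoded in one natural number, so that all blocks fit into \<open>'v \<times> nat\<close>.
\<close>

definition pt :: "'v \<Rightarrow> 'b \<Rightarrow> bool \<Rightarrow> 'v \<times> nat" where
  "pt v b k = (v, to_nat (b, k))"

definition points :: "('v \<times> nat) set" where
  "points = {pt v b k | v b k. b \<in> B \<and> v \<in> V b \<and> (k \<longrightarrow> \<not> (v = r b \<and> b \<in> M))}"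

definition step :: "'v \<times> nat \<Rightarrow> 'v \<times> nat" where
  "step x = (let v = fst x; (b, k) = from_nat (snd x) in
     if k then pt v b False
     else if v = r b then pt (r (nxt b)) (nxt b) False
     else pt (p b v) b False)"

definition assemble :: "('b \<Rightarrow> 'b) \<Rightarrow> ('b \<Rightarrow> 'v \<Rightarrow> 'v) \<Rightarrow> 'v \<times> nat \<Rightarrow> 'v \<times> nat" where
  "assemble \<pi> \<alpha> = (\<lambda>x\<in>points. let v = fst x; (b, k) = from_nat (snd x) in pt (\<alpha> b v) (\<pi> b) k)"

abbreviation root :: "'b \<Rightarrow> 'v \<times> nat" where
  "root b \<equiv> pt (r b) b False"

lemma pt_eq_iff [simp]: "pt v b k = pt v' b' k' \<longleftrightarrow> v = v' \<and> b = b' \<and> k = k'"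
  by (auto simp: pt_def)

lemma pt_mem_points [simp]:
  "pt v b k \<in> points \<longleftrightarrow> b \<in> B \<and> v \<in> V b \<and> (k \<longrightarrow> \<not> (v = r b \<and> b \<in> M))"
  by (auto simp: points_def)

lemma points_cases:
  assumes "x \<in> points"
  obtains v b k where "x = pt v b k" "b \<in> B" "v \<in> V b" "k \<Longrightarrow> \<not> (v = r b \<and> b \<in> M)"
  using assms by (auto simp: points_def)

lemma step_leaf [simp]: "step (pt v b True) = pt v b False"
  and step_root [simp]: "step (root b) = root (nxt b)"
  and step_inner: "v \<noteq> r b \<Longrightarrow> step (pt v b False) = pt (p b v) b False"
  by (auto simp: step_def pt_def)

lemma assemble_pt [simp]: "pt v b k \<in> points \<Longrightarrow> assemble \<pi> \<alpha> (pt v b k) = pt (\<alpha> b v) (\<pi> b) k"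
  by (auto simp: assemble_def pt_def)

lemma assemble_extensional: "assemble \<pi> \<alpha> \<in> extensional points"
  by (simp add: assemble_def)

lemma nxt_mem: "b \<in> B \<Longrightarrow> nxt b \<in> B"
  using nxt_bij by (auto simp: bij_betw_def)

lemma funpow_nxt_mem: "b \<in> B \<Longrightarrow> (nxt ^^ n) b \<in> B"
  by (induction n) (auto intro: nxt_mem)

lemma root_mem_V: "b \<in> B \<Longrightarrow> r b \<in> V b"
  and p_mem_V: "b \<in> B \<Longrightarrow> v \<in> V b \<Longrightarrow> p b v \<in> V b"
  and p_root: "b \<in> B \<Longrightarrow> p b (r b) = r b"
  and p_reaches_root: "b \<in> B \<Longrightarrow> v \<in> V b \<Longrightarrow> \<exists>n. (p b ^^ n) v = r b"
  using tree[of b] by (auto simp: rooted_map_def)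

lemma step_points: "step \<in> points \<rightarrow> points"
proof
  fix x assume "x \<in> points"
  then obtain v b k where x: "x = pt v b k" "b \<in> B" "v \<in> V b" by (rule points_cases)
  show "step x \<in> points"
    using x by (cases k; cases "v = r b") (auto simp: step_inner nxt_mem root_mem_V p_mem_V)
qed

lemma funpow_step_root: "(step ^^ n) (root b) = root ((nxt ^^ n) b)"
  by (induction n) auto

text \<open>
  A vertex is hit by its leaf; a root without leaf is hit by the preceding root.
\<close>

lemma step_image_iff:
  assumes "pt v b k \<in> points"
  shows "pt v b k \<in> step ` points \<longleftrightarrow> \<not> k"
proof
  have "\<exists>w c. step x = pt w c False" for x
    by (auto simp: step_def Let_def split: prod.splits)
  then show "pt v b k \<in> step ` points \<Longrightarrow> \<not> k" by (metis imageE pt_eq_iff)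
  assume k: "\<not> k"
  have b: "b \<in> B" "v \<in> V b" using assms by auto
  show "pt v b k \<in> step ` points"
  proof (cases "v = r b")
    case True
    obtain b' where "b' \<in> B" "nxt b' = b" using nxt_bij b by (metis bij_betw_def imageE)
    then have "pt v b k = step (root b')" "root b' \<in> points"
      using True k by (auto simp: root_mem_V)
    then show ?thesis by blast
  next
    case False
    then have "pt v b k = step (pt v b True)" "pt v b True \<in> points" using b k by auto
    then show ?thesis by blast
  qed
qed

lemma bare_point_iff:
  assumes x: "x \<in> points"
  shows "bare_point points step x \<longleftrightarrow> (\<exists>b\<in>M. x = root b)"
proof
  obtain v b k where xv: "x = pt v b k" and b: "b \<in> B" "v \<in> V b" using x by (rule points_cases)
  assume bare: "bare_point points step x"
  then have "\<not> k" using step_image_iff x unfolding xv bare_point_def by blast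
  have "pt v b True \<notin> points"
  proof
    assume l: "pt v b True \<in> points"
    moreover have "step (pt v b True) = x" using xv \<open>\<not> k\<close> by simp
    ultimately have "pt v b True \<in> step ` points" using bare unfolding bare_point_def by blast
    then show False using step_image_iff[OF l] by simp
  qed
  then show "\<exists>b\<in>M. x = root b" using xv b \<open>\<not> k\<close> by auto
next
  assume "\<exists>b\<in>M. x = root b"
  then obtain b where b: "b \<in> M" "x = root b" by blast
  show "bare_point points step x"
    unfolding bare_point_def
  proof (intro conjI ballI impI)
    show "x \<in> step ` points" using step_image_iff x unfolding b(2) by blast
    fix y assume y: "y \<in> points" "step y = x"
    obtain w c k where yw: "y = pt w c k" "c \<in> B" "w \<in> V c" and l: "k \<Longrightarrow> \<not> (w = r c \<and> c \<in> M)"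
      using y(1) by (rule points_cases) blast
    have "\<not> k"
      using y(2) l b by (cases k) (auto simp: yw)
    then show "y \<in> step ` points" using step_image_iff y(1) yw by blast
  qed
qed

text \<open>
  The roots of blocks in \<open>M\<close> are the bare points, and all other roots are their iterated images.
\<close>

lemma automorphism_maps_root:
  assumes \<sigma>: "commuting_perm points step \<sigma>" and b: "b \<in> B"
  shows "\<exists>c\<in>B. \<sigma> (root b) = root c"
proof -
  obtain m n where m: "m \<in> M" "(nxt ^^ n) m = b" using M_reach b by blast
  have root_m: "root m \<in> points" using m M_sub root_mem_V by auto
  have "bare_point points step (\<sigma> (root m))"
    using commuting_perm_bare_point[OF \<sigma> step_points root_m] bare_point_iff[OF root_m] m by blast
  moreover have "\<sigma> (root m) \<in> points" using \<sigma> root_m by (auto simp: commuting_perm_def bij_betw_def)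
  ultimately obtain m' where m': "m' \<in> M" "\<sigma> (root m) = root m'"
    using bare_point_iff by blast
  have "\<sigma> (root b) = (step ^^ n) (\<sigma> (root m))"
    using commuting_perm_funpow[OF \<sigma> step_points root_m] m by (metis funpow_step_root)
  also have "\<dots> = root ((nxt ^^ n) m')" using m' funpow_step_root by simp
  finally show ?thesis using m' M_sub funpow_nxt_mem by blast
qed

text \<open>
  Induction on the distance of \<open>v\<close> from the root. The parent of \<open>v\<close> is mapped into block \<open>c\<close>, and one
  step takes the image of \<open>v\<close> there. So the image of \<open>v\<close> could lie outside \<open>c\<close> only by being the
  preceding root, which is impossible since the inverse automorphism maps roots to roots.
\<close>

lemma automorphism_maps_block:
  assumes \<sigma>: "commuting_perm points step \<sigma>" and b: "b \<in> B" and c: "\<sigma> (root b) = root c"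
    and v: "v \<in> V b"
  shows "\<exists>w\<in>V c. \<sigma> (pt v b False) = pt w c False \<and> (w = r c \<longleftrightarrow> v = r b)"
proof -
  let ?\<tau> = "inv_into points \<sigma>"
  have \<sigma>p: "\<sigma> x \<in> points" "?\<tau> (\<sigma> x) = x" if "x \<in> points" for x
    using \<sigma> that by (auto simp: commuting_perm_def bij_betw_def)
  have "c \<in> B" using automorphism_maps_root[OF \<sigma> b] c by auto
  obtain n where "(p b ^^ n) v = r b" using p_reaches_root b v by blast
  then show ?thesis using v
  proof (induction n arbitrary: v)
    case 0
    then show ?case using c root_mem_V \<open>c \<in> B\<close> by auto
  next
    case (Suc n)
    show ?case
    proof (cases "v = r b")
      case True
      then show ?thesis using c root_mem_V \<open>c \<in> B\<close> by auto
    next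
      case False
      let ?x = "pt v b False"
      have x: "?x \<in> points" using b Suc.prems by simp
      have "(p b ^^ n) (p b v) = r b" using Suc.prems(1) by (simp add: funpow_swap1)
      then obtain w' where w': "\<sigma> (pt (p b v) b False) = pt w' c False"
        using Suc.IH p_mem_V[OF b Suc.prems(2)] by blast
      have step_\<sigma>: "step (\<sigma> ?x) = pt w' c False"
        using \<sigma> x w' step_inner[OF False] unfolding commuting_perm_def by metis
      obtain w d k where wd: "\<sigma> ?x = pt w d k" "d \<in> B" "w \<in> V d"
        using \<sigma>p(1)[OF x] by (rule points_cases)
      have "?x \<in> step ` points" using step_image_iff[OF x] by simp
      then have "\<not> k"
        using commuting_perm_image_iff[OF \<sigma> step_points x] step_image_iff wd \<sigma>p(1)[OF x] by metis
      have "w \<noteq> r d"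
      proof
        assume "w = r d"
        then have "\<sigma> ?x = root d" using wd \<open>\<not> k\<close> by simp
        then have "?x = ?\<tau> (root d)" using \<sigma>p(2)[OF x] by simp
        then obtain e where "?x = root e"
          using automorphism_maps_root[OF commuting_perm_inv[OF \<sigma> step_points] wd(2)] by auto
        then show False using False by auto
      qed
      then have "d = c" using step_\<sigma> wd(1) \<open>\<not> k\<close> by (auto simp: step_inner)
      then show ?thesis using wd \<open>\<not> k\<close> \<open>w \<noteq> r d\<close> False by auto
    qed
  qed
qed

text \<open>
  Reading off the action on roots gives \<open>\<pi>\<close>, the action on the vertices of a block gives \<open>\<alpha>\<close>, and a leaf
  goes to the leaf of the image of its vertex. Surjectivity of \<open>\<alpha> b\<close> comes from
  \<open>automorphism_maps_block\<close> for the inverse automorphism.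
\<close>

theorem automorphism_decompose:
  assumes \<sigma>: "commuting_perm points step \<sigma>"
  obtains \<pi> \<alpha> where
    "\<And>b. b \<in> B \<Longrightarrow> \<pi> b \<in> B" "\<And>b. b \<in> B \<Longrightarrow> \<pi> (nxt b) = nxt (\<pi> b)" "\<And>b. b \<in> M \<Longrightarrow> \<pi> b \<in> M"
    "\<And>b. b \<in> B \<Longrightarrow> bij_betw (\<alpha> b) (V b) (V (\<pi> b))"
    "\<And>b v. b \<in> B \<Longrightarrow> v \<in> V b \<Longrightarrow> \<alpha> b (p b v) = p (\<pi> b) (\<alpha> b v)"
    "\<And>v b k. pt v b k \<in> points \<Longrightarrow> \<sigma> (pt v b k) = pt (\<alpha> b v) (\<pi> b) k"
proof -
  let ?\<tau> = "inv_into points \<sigma>"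
  have bij: "bij_betw \<sigma> points points" using \<sigma> by (simp add: commuting_perm_def)
  have \<sigma>p: "\<sigma> x \<in> points" "?\<tau> (\<sigma> x) = x" if "x \<in> points" for x
    using bij that by (auto simp: bij_betw_def)
  have \<tau>: "commuting_perm points step ?\<tau>" using commuting_perm_inv[OF \<sigma> step_points] .
  have comm: "\<sigma> (step x) = step (\<sigma> x)" if "x \<in> points" for x
    using \<sigma> that by (simp add: commuting_perm_def)
  obtain \<pi> where \<pi>: "\<And>b. b \<in> B \<Longrightarrow> \<pi> b \<in> B \<and> \<sigma> (root b) = root (\<pi> b)"
    using automorphism_maps_root[OF \<sigma>] by metis
  define \<alpha> where "\<alpha> b v = fst (\<sigma> (pt v b False))" for b v
  have root_pts: "root b \<in> points" if "b \<in> B" for b using that root_mem_V by auto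
  have \<alpha>: "\<alpha> b v \<in> V (\<pi> b) \<and> \<sigma> (pt v b False) = pt (\<alpha> b v) (\<pi> b) False \<and> (\<alpha> b v = r (\<pi> b) \<longleftrightarrow> v = r b)"
    if "b \<in> B" "v \<in> V b" for b v
    using automorphism_maps_block[OF \<sigma> that(1) _ that(2)] \<pi>[OF that(1)]
    by (auto simp: \<alpha>_def pt_def)
  have 1: "\<pi> (nxt b) = nxt (\<pi> b)" if "b \<in> B" for b
    using comm[OF root_pts[OF that]] \<pi>[OF that] \<pi>[OF nxt_mem[OF that]] by simp
  have 2: "\<pi> b \<in> M" if "b \<in> M" for b
  proof -
    have b: "b \<in> B" using that M_sub by auto
    have "bare_point points step (\<sigma> (root b))"
      using commuting_perm_bare_point[OF \<sigma> step_points root_pts[OF b]] bare_point_iff[OF root_pts[OF b]] that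
      by blast
    then show ?thesis
      using bare_point_iff[OF \<sigma>p(1)[OF root_pts[OF b]]] \<pi>[OF b] by auto
  qed
  have 3: "bij_betw (\<alpha> b) (V b) (V (\<pi> b))" if b: "b \<in> B" for b
    unfolding bij_betw_def
  proof
    show "inj_on (\<alpha> b) (V b)"
    proof (rule inj_onI)
      fix v w assume vw: "v \<in> V b" "w \<in> V b" "\<alpha> b v = \<alpha> b w"
      then have "\<sigma> (pt v b False) = \<sigma> (pt w b False)" using \<alpha> b by metis
      then have "pt v b False = pt w b False" using \<sigma>p(2) vw b pt_mem_points by metis
      then show "v = w" by simp
    qed
    show "\<alpha> b ` V b = V (\<pi> b)"
    proof
      show "\<alpha> b ` V b \<subseteq> V (\<pi> b)" using \<alpha> b by auto
      show "V (\<pi> b) \<subseteq> \<alpha> b ` V b"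
      proof
        fix w assume w: "w \<in> V (\<pi> b)"
        have "?\<tau> (root (\<pi> b)) = root b" using \<pi>[OF b] \<sigma>p(2)[OF root_pts[OF b]] by simp
        then obtain v where v: "v \<in> V b" "?\<tau> (pt w (\<pi> b) False) = pt v b False"
          using automorphism_maps_block[OF \<tau> _ _ w] \<pi>[OF b] by blast
        have "\<sigma> (?\<tau> (pt w (\<pi> b) False)) = pt w (\<pi> b) False"
          using bij w \<pi>[OF b] by (intro f_inv_into_f) (auto simp: bij_betw_def)
        then have "\<alpha> b v = w" using v \<alpha>_def by (simp add: pt_def)
        then show "w \<in> \<alpha> b ` V b" using v by blast
      qed
    qed
  qed
  have 4: "\<alpha> b (p b v) = p (\<pi> b) (\<alpha> b v)" if b: "b \<in> B" and v: "v \<in> V b" for b v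
  proof (cases "v = r b")
    case True
    then have "\<alpha> b v = r (\<pi> b)" using \<alpha> b v by blast
    then show ?thesis using True p_root b \<pi> by metis
  next
    case False
    have "\<sigma> (pt (p b v) b False) = step (\<sigma> (pt v b False))"
      using comm[of "pt v b False"] b v False by (simp add: step_inner)
    then show ?thesis
      using \<alpha>[OF b v] \<alpha>[OF b p_mem_V[OF b v]] False by (simp add: step_inner)
  qed
  have 5: "\<sigma> (pt v b k) = pt (\<alpha> b v) (\<pi> b) k" if x: "pt v b k \<in> points" for v b k
  proof (cases k)
    case True
    have b: "b \<in> B" "v \<in> V b" using x by auto
    obtain w c l where w: "\<sigma> (pt v b k) = pt w c l" "c \<in> B" "w \<in> V c"
      using \<sigma>p(1)[OF x] by (rule points_cases)
    have "pt w c l \<notin> step ` points"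
      using commuting_perm_image_iff[OF \<sigma> step_points x] step_image_iff[OF x] True w(1) by metis
    then have l using step_image_iff \<sigma>p(1)[OF x] w(1) by metis
    then show ?thesis
      using comm[OF x] \<alpha>[OF b] w True by simp
  qed (use \<alpha> x in auto)
  show thesis
    by (rule that[of \<pi> \<alpha>]) (use \<pi> 1 2 3 4 5 in blast)+
qed

text \<open>
  As the root is the only fixed point of its parent map, \<open>\<alpha> b\<close> takes the root of \<open>b\<close> to that of \<open>\<pi> b\<close>.
  Hence connections between blocks are respected, and so are missing leaves, since \<open>\<pi>\<close> preserves \<open>M\<close>.
\<close>

theorem assemble_automorphism:
  assumes \<pi>: "bij_betw \<pi> B B" and nxt: "\<And>b. b \<in> B \<Longrightarrow> \<pi> (nxt b) = nxt (\<pi> b)"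
    and M: "\<And>b. b \<in> B \<Longrightarrow> \<pi> b \<in> M \<longleftrightarrow> b \<in> M"
    and bij: "\<And>b. b \<in> B \<Longrightarrow> bij_betw (\<alpha> b) (V b) (V (\<pi> b))"
    and comm: "\<And>b v. b \<in> B \<Longrightarrow> v \<in> V b \<Longrightarrow> \<alpha> b (p b v) = p (\<pi> b) (\<alpha> b v)"
  shows "commuting_perm points step (assemble \<pi> \<alpha>)"
proof -
  let ?\<sigma> = "assemble \<pi> \<alpha>"
  have \<pi>B: "\<pi> b \<in> B" if "b \<in> B" for b using \<pi> that by (auto simp: bij_betw_def)
  have \<alpha>V: "\<alpha> b v \<in> V (\<pi> b)" if "b \<in> B" "v \<in> V b" for b v using bij that by (auto simp: bij_betw_def)
  have \<alpha>_inj: "\<alpha> b v = \<alpha> b w \<longleftrightarrow> v = w" if "b \<in> B" "v \<in> V b" "w \<in> V b" for b v w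
    using bij[OF that(1)] that by (auto simp: bij_betw_def inj_on_def)
  have \<alpha>_r: "\<alpha> b (r b) = r (\<pi> b)" if b: "b \<in> B" for b
    using rooted_map_fixpoint_unique[OF tree[OF \<pi>B[OF b]] \<alpha>V[OF b root_mem_V[OF b]]]
      comm[OF b root_mem_V[OF b]] p_root[OF b] by simp
  have \<alpha>_root: "\<alpha> b v = r (\<pi> b) \<longleftrightarrow> v = r b" if "b \<in> B" "v \<in> V b" for b v
    using \<alpha>_inj[OF that root_mem_V[OF that(1)]] \<alpha>_r[OF that(1)] by simp
  have mem: "pt (\<alpha> b v) (\<pi> b) k \<in> points" if "pt v b k \<in> points" for v b k
    using that by (auto simp: \<pi>B \<alpha>V \<alpha>_root M)
  have "inj_on ?\<sigma> points"
  proof (rule inj_onI)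
    fix x y assume x: "x \<in> points" and y: "y \<in> points" and eq: "?\<sigma> x = ?\<sigma> y"
    obtain v b k where xv: "x = pt v b k" "b \<in> B" "v \<in> V b" using x by (rule points_cases)
    obtain w c l where yw: "y = pt w c l" "c \<in> B" "w \<in> V c" using y by (rule points_cases)
    have e: "\<alpha> b v = \<alpha> c w" "\<pi> b = \<pi> c" "k = l"
      using eq assemble_pt[OF x[unfolded xv(1)]] assemble_pt[OF y[unfolded yw(1)]] xv yw by auto
    then have "b = c" using \<pi> xv yw by (auto simp: bij_betw_def inj_on_def)
    then show "x = y" using e xv yw \<alpha>_inj by auto
  qed
  moreover have "?\<sigma> ` points = points"
  proof
    show "?\<sigma> ` points \<subseteq> points"
    proof
      fix y assume "y \<in> ?\<sigma> ` points"
      then obtain x where x: "x \<in> points" "y = ?\<sigma> x" by blast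
      obtain v b k where "x = pt v b k" using x(1) by (rule points_cases)
      then show "y \<in> points" using x mem assemble_pt by metis
    qed
    show "points \<subseteq> ?\<sigma> ` points"
    proof
      fix y assume y: "y \<in> points"
      obtain w c k where yw: "y = pt w c k" "c \<in> B" "w \<in> V c" and l: "k \<Longrightarrow> \<not> (w = r c \<and> c \<in> M)"
        using y by (rule points_cases) blast
      obtain b where b: "b \<in> B" "\<pi> b = c" using \<pi> yw(2) by (metis bij_betw_def imageE)
      obtain v where v: "v \<in> V b" "\<alpha> b v = w" using bij[OF b(1)] yw(3) b by (metis bij_betw_def imageE)
      have x: "pt v b k \<in> points" using b v l \<alpha>_root M by auto
      have "?\<sigma> (pt v b k) = y" using assemble_pt[OF x] yw b v by simp
      then show "y \<in> ?\<sigma> ` points" using x by blast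
    qed
  qed
  moreover have "?\<sigma> (step x) = step (?\<sigma> x)" if x: "x \<in> points" for x
  proof -
    obtain v b k where xv: "x = pt v b k" "b \<in> B" "v \<in> V b" using x by (rule points_cases)
    have "step x \<in> points" using step_points x by auto
    show ?thesis
    proof (cases k)
      case True
      then show ?thesis using xv x by simp
    next
      case False
      then show ?thesis
        using xv x by (cases "v = r b")
          (auto simp: \<alpha>_r \<alpha>_root nxt nxt_mem root_mem_V p_mem_V step_inner comm)
    qed
  qed
  ultimately show ?thesis by (simp add: commuting_perm_def bij_betw_def)
qed

lemma reaches_root:
  assumes "x \<in> points"
  shows "\<exists>n. \<exists>b\<in>B. (step ^^ n) x = root b"
proof -
  have inner: "\<exists>n. (step ^^ n) (pt v b False) = root b" if b: "b \<in> B" "v \<in> V b" for v b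
  proof -
    obtain n where "(p b ^^ n) v = r b" using p_reaches_root b by blast
    then show ?thesis using b(2)
    proof (induction n arbitrary: v)
      case 0
      then show ?case by (intro exI[of _ 0]) auto
    next
      case (Suc n)
      show ?case
      proof (cases "v = r b")
        case True
        then show ?thesis by (intro exI[of _ 0]) auto
      next
        case False
        have "(p b ^^ n) (p b v) = r b" using Suc.prems(1) by (simp add: funpow_swap1)
        then obtain m where "(step ^^ m) (pt (p b v) b False) = root b"
          using Suc.IH p_mem_V b(1) Suc.prems(2) by blast
        then show ?thesis
          using False by (intro exI[of _ "Suc m"]) (simp add: funpow_Suc_right step_inner del: funpow.simps)
      qed
    qed
  qed
  obtain v b k where x: "x = pt v b k" "b \<in> B" "v \<in> V b" using assms by (rule points_cases)
  obtain n where n: "(step ^^ n) (pt v b False) = root b" using inner x by blast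
  show ?thesis
  proof (cases k)
    case True
    then have "(step ^^ Suc n) x = root b" using n x by (simp add: funpow_Suc_right del: funpow.simps)
    then show ?thesis using x by blast
  next
    case False
    then show ?thesis using n x by auto
  qed
qed

lemma connected_step:
  assumes "connected_fun B nxt"
  shows "connected_fun points step"
  unfolding connected_fun_def
proof (intro ballI)
  fix x y assume "x \<in> points" "y \<in> points"
  then obtain m b n c where b: "b \<in> B" "(step ^^ m) x = root b" and c: "c \<in> B" "(step ^^ n) y = root c"
    using reaches_root by metis
  obtain m' n' where "(nxt ^^ m') b = (nxt ^^ n') c"
    using assms b c unfolding connected_fun_def by blast
  then have "(step ^^ (m' + m)) x = (step ^^ (n' + n)) y"
    using b c by (simp add: funpow_add funpow_step_root)
  then show "\<exists>m n. (step ^^ m) x = (step ^^ n) y" by blast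
qed

lemma forward_orbit_root: "forward_orbit step (root b) = root ` forward_orbit nxt b"
  by (auto simp: forward_orbit_def funpow_step_root)

lemma infinite_forward_orbit_step:
  assumes "\<And>b. b \<in> B \<Longrightarrow> infinite (forward_orbit nxt b)" and "x \<in> points"
  shows "infinite (forward_orbit step x)"
proof
  assume fin: "finite (forward_orbit step x)"
  obtain n b where b: "b \<in> B" "(step ^^ n) x = root b" using reaches_root assms(2) by blast
  have "(step ^^ m) (root b) = (step ^^ (m + n)) x" for m using b by (simp add: funpow_add)
  then have "forward_orbit step (root b) \<subseteq> forward_orbit step x"
    unfolding forward_orbit_def by blast
  then have "finite (root ` forward_orbit nxt b)"
    using fin finite_subset forward_orbit_root by metis
  moreover have "inj_on root (forward_orbit nxt b)" by (auto intro: inj_onI)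
  ultimately show False using assms(1)[OF b(1)] finite_imageD by blast
qed

text \<open>
  Every orbit eventually consists of roots, and a periodic point recurs arbitrarily late in its orbit.
\<close>

lemma periodic_point_is_root:
  assumes x: "x \<in> points" and n: "n > 0" "(step ^^ n) x = x"
  shows "\<exists>b\<in>B. x = root b"
proof -
  obtain m b where b: "b \<in> B" "(step ^^ m) x = root b" using reaches_root x by blast
  have per: "(step ^^ (k * n)) x = x" for k
    using n(2) by (induction k) (auto simp: funpow_add)
  have "m * n = (m * n - m) + m" using n(1) by simp
  then have "x = (step ^^ (m * n - m)) ((step ^^ m) x)"
    using per[of m] by (metis comp_apply funpow_add)
  then show ?thesis using b funpow_step_root funpow_nxt_mem by metis
qed

lemma cyclic_orbit_step_iff:
  assumes orbit: "\<And>b. b \<in> B \<Longrightarrow> forward_orbit nxt b = B"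
    and b0: "b0 \<in> B" "n0 > 0" "(nxt ^^ n0) b0 = b0"
  shows "cyclic_orbit points step C \<longleftrightarrow> C = root ` B"
proof
  assume "cyclic_orbit points step C"
  then obtain x n where x: "x \<in> points" "C = forward_orbit step x" "n > 0" "(step ^^ n) x = x"
    by (auto simp: cyclic_orbit_def)
  obtain b where b: "b \<in> B" "x = root b" using periodic_point_is_root x by blast
  show "C = root ` B" using x(2) orbit[OF b(1)] by (simp add: b(2) forward_orbit_root)
next
  assume "C = root ` B"
  then have "C = forward_orbit step (root b0)" using orbit b0 forward_orbit_root by simp
  moreover have "(step ^^ n0) (root b0) = root b0" using b0 funpow_step_root by simp
  moreover have "root b0 \<in> points" using b0 root_mem_V by simp
  ultimately show "cyclic_orbit points step C" unfolding cyclic_orbit_def using b0 by blast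
qed

end

section \<open>The cyclic order of the blocks\<close>

text \<open>
  The block \<open>(i, j)\<close> is the copy of the \<open>i\<close>-th tree at \<open>j \<in> \<int>/s\<close>; the second coordinate changes only
  when a round of \<open>t\<close> trees is completed.
\<close>

definition advance :: "nat \<Rightarrow> nat \<Rightarrow> nat \<times> int \<Rightarrow> nat \<times> int" where
  "advance t s = (\<lambda>(i, j). if i < t then (Suc i, j) else (1, (j + 1) mod int s))"

abbreviation residues :: "nat \<Rightarrow> int set" where
  "residues s \<equiv> carrier (integer_mod_group s)"

text \<open>
  This description covers \<open>s = 0\<close>, where the group is \<open>\<int>\<close> and reduction modulo \<open>0\<close> does nothing.
\<close>

lemma residues_iff: "j \<in> residues s \<longleftrightarrow> j mod int s = j"
  by (auto simp: carrier_integer_mod_group)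
     (metis of_nat_0_less_iff pos_mod_sign pos_mod_bound neq0_conv)+

lemma mod_residues [simp]: "j mod int s \<in> residues s"
  by (simp add: residues_iff)

lemma advance_mem:
  assumes "t \<ge> 1" "b \<in> {1..t} \<times> residues s"
  shows "advance t s b \<in> {1..t} \<times> residues s"
  using assms by (auto simp: advance_def)

lemma bij_betw_advance:
  assumes t: "t \<ge> 1"
  shows "bij_betw (advance t s) ({1..t} \<times> residues s) ({1..t} \<times> residues s)"
  by (rule bij_betw_byWitness[where f' = "\<lambda>(i, j). if 1 < i then (i - 1, j) else (t, (j - 1) mod int s)"])
     (use t in \<open>auto simp: advance_def residues_iff mod_simps split: if_splits\<close>)

lemma funpow_advance:
  assumes t: "t \<ge> 1" and j: "j \<in> residues s"
  shows "(advance t s ^^ n) (1, j) = (Suc (n mod t), (j + int (n div t)) mod int s)"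
proof (induction n)
  case 0
  then show ?case using j by (simp add: residues_iff)
next
  case (Suc n)
  have "(advance t s ^^ Suc n) (1, j) = advance t s (Suc (n mod t), (j + int (n div t)) mod int s)"
    using Suc by simp
  also have "\<dots> = (Suc (Suc n mod t), (j + int (Suc n div t)) mod int s)"
  proof (cases "Suc (n mod t) = t")
    case True
    then show ?thesis by (simp add: advance_def mod_Suc div_Suc mod_simps ac_simps)
  next
    case False
    then have "Suc (n mod t) < t" using t by (simp add: Suc_lessI)
    then show ?thesis by (simp add: advance_def mod_Suc div_Suc)
  qed
  finally show ?case .
qed

lemma funpow_advance_index:
  assumes "t \<ge> 1" "j \<in> residues s" "i \<in> {1..t}"
  shows "(advance t s ^^ (t * n + (i - 1))) (1, j) = (i, (j + int n) mod int s)"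
proof -
  have "i - 1 < t" using assms by auto
  then have "(t * n + (i - 1)) mod t = i - 1" "(t * n + (i - 1)) div t = n" by auto
  then show ?thesis using funpow_advance[OF assms(1,2), of "t * n + (i - 1)"] assms(3) by simp
qed

lemma block_reached_from_first:
  assumes "t \<ge> 1" "j \<in> residues s" "i \<in> {1..t}"
  shows "(advance t s ^^ (i - 1)) (1, j) = (i, j)"
  using funpow_advance_index[OF assms, of 0] assms(2) by (simp add: residues_iff)

lemma funpow_advance_round:
  assumes "t \<ge> 1" "j \<in> residues s"
  shows "(advance t s ^^ (t * n)) (1, j) = (1, (j + int n) mod int s)"
  using funpow_advance_index[OF assms, of 1 n] assms(1) by simp

lemma block_reaches_first:
  assumes "t \<ge> 1" "b \<in> {1..t} \<times> residues s"
  shows "\<exists>n. \<exists>j\<in>residues s. (advance t s ^^ n) b = (1, j)"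
proof -
  obtain i j where b: "b = (i, j)" "i \<in> {1..t}" "j \<in> residues s" using assms(2) by blast
  have "(t - (i - 1)) + (i - 1) = t * 1" using b(2) by auto
  then have "(advance t s ^^ (t - (i - 1))) ((advance t s ^^ (i - 1)) (1, j)) = (1, (j + int 1) mod int s)"
    using funpow_advance_round[OF assms(1) b(3), of 1] by (metis comp_apply funpow_add)
  then have "(advance t s ^^ (t - (i - 1))) b = (1, (j + int 1) mod int s)"
    unfolding b(1) block_reached_from_first[OF assms(1) b(3,2)] .
  then show ?thesis using mod_residues by blast
qed

lemma connected_advance:
  assumes t: "t \<ge> 1"
  shows "connected_fun ({1..t} \<times> residues s) (advance t s)"
  unfolding connected_fun_def
proof (intro ballI)
  let ?f = "advance t s"
  have ordered: "\<exists>m n. (?f ^^ m) (1, j) = (?f ^^ n) (1, j')"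
    if "j \<in> residues s" "j' \<in> residues s" "j \<le> j'" for j j'
  proof -
    have "(?f ^^ (t * nat (j' - j))) (1, j) = (1, j')"
      using funpow_advance_round[OF t that(1), of "nat (j' - j)"] that by (simp add: residues_iff)
    then show ?thesis by (metis funpow_0)
  qed
  have first: "\<exists>m n. (?f ^^ m) (1, j) = (?f ^^ n) (1, j')"
    if "j \<in> residues s" "j' \<in> residues s" for j j'
    using ordered[OF that] ordered[OF that(2,1)] by (metis linear)
  fix b c assume b: "b \<in> {1..t} \<times> residues s" and c: "c \<in> {1..t} \<times> residues s"
  obtain m j where j: "j \<in> residues s" "(?f ^^ m) b = (1, j)"
    using block_reaches_first[OF t b] by blast
  obtain n j' where j': "j' \<in> residues s" "(?f ^^ n) c = (1, j')"
    using block_reaches_first[OF t c] by blast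
  obtain m' n' where "(?f ^^ m') (1, j) = (?f ^^ n') (1, j')" using first j j' by blast
  then have "(?f ^^ (m' + m)) b = (?f ^^ (n' + n)) c" using j j' by (simp add: funpow_add)
  then show "\<exists>m n. (?f ^^ m) b = (?f ^^ n) c" by blast
qed

lemma forward_orbit_advance_finite:
  assumes t: "t \<ge> 1" and s: "s \<ge> 1" and b: "b \<in> {1..t} \<times> residues s"
  shows "forward_orbit (advance t s) b = {1..t} \<times> residues s"
proof
  let ?f = "advance t s"
  have mem: "(?f ^^ n) b \<in> {1..t} \<times> residues s" for n
  proof (induction n)
    case (Suc n)
    then show ?case using advance_mem[OF t] by simp
  qed (use b in simp)
  then show "forward_orbit ?f b \<subseteq> {1..t} \<times> residues s"
    unfolding forward_orbit_def by blast
  obtain n j where j: "j \<in> residues s" "(?f ^^ n) b = (1, j)" using block_reaches_first[OF t b] by blast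
  show "{1..t} \<times> residues s \<subseteq> forward_orbit ?f b"
  proof
    fix c assume "c \<in> {1..t} \<times> residues s"
    then obtain i k where c: "c = (i, k)" "i \<in> {1..t}" "k \<in> residues s" by blast
    \<comment> \<open>After \<open>m\<close> full rounds the second coordinate has moved from \<open>j\<close> to \<open>k\<close>.\<close>
    define m where "m = nat ((k - j) mod int s)"
    have "int m = (k - j) mod int s" using s by (simp add: m_def)
    then have "(j + int m) mod int s = k" using c(3) by (simp add: residues_iff mod_simps)
    then have "(?f ^^ (t * m + (i - 1))) (1, j) = c"
      using funpow_advance_index[OF t j(1) c(2), of m] c(1) by simp
    then have "(?f ^^ (t * m + (i - 1) + n)) b = c" using j by (simp add: funpow_add)
    then show "c \<in> forward_orbit ?f b" unfolding forward_orbit_def by blast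
  qed
qed

lemma forward_orbit_advance_infinite:
  assumes t: "t \<ge> 1" and b: "b \<in> {1..t} \<times> residues 0"
  shows "infinite (forward_orbit (advance t 0) b)"
proof
  let ?f = "advance t 0"
  assume fin: "finite (forward_orbit ?f b)"
  obtain n j where j: "j \<in> residues 0" "(?f ^^ n) b = (1, j)" using block_reaches_first[OF t b] by blast
  have "(1, j + int m) \<in> forward_orbit ?f b" for m
  proof -
    have "(?f ^^ (t * m + n)) b = (1, j + int m)"
      using funpow_advance_round[OF t j(1), of m] j(2) by (simp add: funpow_add)
    then show ?thesis unfolding forward_orbit_def by (metis (mono_tags, lifting) mem_Collect_eq)
  qed
  then have "range (\<lambda>m. (1 :: nat, j + int m)) \<subseteq> forward_orbit ?f b" by auto
  then have "finite (range (\<lambda>m. (1 :: nat, j + int m)))" using fin finite_subset by blast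
  then have "finite (UNIV :: nat set)" by (rule finite_imageD) (auto intro: inj_onI)
  then show False by simp
qed

text \<open>
  A map that commutes with \<open>advance\<close> and preserves the set of blocks \<open>(1, j)\<close> commutes there with
  the full round \<open>j \<mapsto> j + 1\<close>, hence is determined by the image of \<open>(1, 0)\<close>. For \<open>s = 0\<close> the
  induction has to run in both directions.
\<close>

lemma advance_symmetry_is_shift:
  assumes t: "t \<ge> 1"
    and comm: "\<And>b. b \<in> {1..t} \<times> residues s \<Longrightarrow> \<pi> (advance t s b) = advance t s (\<pi> b)"
    and first: "\<And>j. j \<in> residues s \<Longrightarrow> \<pi> (1, j) \<in> {1} \<times> residues s"
  shows "\<exists>h\<in>residues s. \<forall>i\<in>{1..t}. \<forall>j\<in>residues s. \<pi> (i, j) = (i, (h + j) mod int s)"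
proof -
  let ?f = "advance t s" and ?B = "{1..t} \<times> residues s"
  have pow: "\<pi> ((?f ^^ n) b) = (?f ^^ n) (\<pi> b)" if b: "b \<in> ?B" for n b
  proof -
    have "(?f ^^ n) b \<in> ?B" for n
    proof (induction n)
      case (Suc n)
      then show ?case using advance_mem[OF t] by simp
    qed (use b in simp)
    then show ?thesis using comm by (induction n) auto
  qed
  have B1: "(1, j) \<in> ?B" if "j \<in> residues s" for j using t that by simp
  have round: "\<pi> (1, (j + 1) mod int s) = (1, (j' + 1) mod int s)"
    if "j \<in> residues s" "\<pi> (1, j) = (1, j')" "j' \<in> residues s" for j j'
    using pow[OF B1[OF that(1)], of "t * 1"] funpow_advance_round[OF t that(1), of 1]
      funpow_advance_round[OF t that(3), of 1] that(2) by simp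
  have "\<pi> (1, 0) \<in> {1} \<times> residues s" using first by (simp add: residues_iff)
  then obtain h where h: "h \<in> residues s" "\<pi> (1, 0) = (1, h)" by blast
  have shift: "\<pi> (1, k mod int s) = (1, (h + k) mod int s)" for k :: int
  proof (induction k rule: int_induct[where k = 0])
    case base
    then show ?case using h by (simp add: residues_iff)
  next
    case (step1 k)
    show ?case using round[OF _ step1(2)] by (simp add: mod_simps ac_simps)
  next
    case (step2 k)
    obtain j where j: "j \<in> residues s" "\<pi> (1, (k - 1) mod int s) = (1, j)"
      using first[of "(k - 1) mod int s"] by auto
    have "(h + k) mod int s = (j + 1) mod int s"
      using round[OF _ j(2) j(1)] step2(2) by (simp add: mod_simps)
    then have "(h + k - 1) mod int s = (j + 1 - 1) mod int s"
      by (metis mod_diff_left_eq)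
    then show ?case using j by (simp add: residues_iff algebra_simps)
  qed
  have "\<pi> (i, j) = (i, (h + j) mod int s)" if i: "i \<in> {1..t}" and j: "j \<in> residues s" for i j
  proof -
    have "\<pi> (1, j) = (1, (h + j) mod int s)" using shift[of j] j by (simp add: residues_iff)
    then show ?thesis
      using pow[OF B1[OF j], of "i - 1"] block_reached_from_first[OF t j i]
        block_reached_from_first[OF t mod_residues i] by simp
  qed
  then show ?thesis using h by blast
qed

section \<open>The wreath product as an automorphism group\<close>

text \<open>
  The necklace with a copy of the \<open>i\<close>-th tree at each \<open>j \<in> \<int>/s\<close>, the trees being given by parent
  maps \<open>q i\<close> with roots \<open>z i\<close>; it is infinite if \<open>s = 0\<close>. The isomorphism \<open>\<phi> i\<close> lets \<open>G i\<close> act on them.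
\<close>

locale tree_necklace =
  fixes t s :: nat and U :: "nat \<Rightarrow> 'v set" and q :: "nat \<Rightarrow> 'v \<Rightarrow> 'v" and z :: "nat \<Rightarrow> 'v"
    and G :: "nat \<Rightarrow> 'g monoid" and \<phi> :: "nat \<Rightarrow> 'g \<Rightarrow> 'v \<Rightarrow> 'v"
  assumes t: "t \<ge> 1"
    and rooted: "\<And>i. i \<in> {1..t} \<Longrightarrow> rooted_map (U i) (q i) (z i)"
    and iso: "\<And>i. i \<in> {1..t} \<Longrightarrow> \<phi> i \<in> iso (G i) (fun_Aut (U i) (q i))"
begin

definition blocks :: "(nat \<times> int) set" where
  "blocks = {1..t} \<times> residues s"

definition first_blocks :: "(nat \<times> int) set" where
  "first_blocks = {1} \<times> residues s"

lemma mem_blocks [simp]: "(i, j) \<in> blocks \<longleftrightarrow> i \<in> {1..t} \<and> j \<in> residues s"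
  by (simp add: blocks_def)

lemma mem_first_blocks [simp]: "(i, j) \<in> first_blocks \<longleftrightarrow> i = 1 \<and> j \<in> residues s"
  by (simp add: first_blocks_def)

text \<open>
  Leaving out the leaves at the roots of the copies of the first tree marks the beginning of each
  round.
\<close>

sublocale necklace blocks "advance t s" first_blocks
  "\<lambda>b. U (fst b)" "\<lambda>b. q (fst b)" "\<lambda>b. z (fst b)"
proof
  show "bij_betw (advance t s) blocks blocks"
    using bij_betw_advance[OF t] by (simp add: blocks_def)
  show "first_blocks \<subseteq> blocks" using t by (auto simp: blocks_def first_blocks_def)
  show "\<exists>m\<in>first_blocks. \<exists>n. (advance t s ^^ n) m = b" if "b \<in> blocks" for b
    using that block_reached_from_first[OF t] unfolding blocks_def first_blocks_def by blast
  show "rooted_map (U (fst b)) (q (fst b)) (z (fst b))" if "b \<in> blocks" for b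
    using that rooted by (auto simp: blocks_def)
qed

definition W :: "((int \<Rightarrow> nat \<Rightarrow> 'g) \<times> int) monoid" where
  "W = wreath_product (product_group {1..t} G) (integer_mod_group s)
         (residues s) (translation_action (integer_mod_group s))"

text \<open>
  The coordinate of \<open>a\<close> that acts on a block is the one at the target \<open>h + j\<close>: first the necklace is
  shifted by \<open>h\<close>, and then \<open>a\<close> acts in the new places. This matches the convention that in
  \<open>(a, h) (b, k)\<close> the coordinates of \<open>b\<close> are moved by \<open>h\<close>.
\<close>

definition realize :: "(int \<Rightarrow> nat \<Rightarrow> 'g) \<times> int \<Rightarrow> 'v \<times> nat \<Rightarrow> 'v \<times> nat" where
  "realize = (\<lambda>(a, h). assemble (\<lambda>(i, j). (i, (h + j) mod int s)) (\<lambda>(i, j). \<phi> i (a ((h + j) mod int s) i)))"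


lemma carrier_W: "carrier W = (residues s \<rightarrow>\<^sub>E (\<Pi>\<^sub>E i\<in>{1..t}. carrier (G i))) \<times> residues s"
  by (simp add: W_def wreath_product_def semidirect_product_def)

lemma mult_W:
  assumes "(a, h) \<in> carrier W" "(b, k) \<in> carrier W"
  shows "(a, h) \<otimes>\<^bsub>W\<^esub> (b, k) =
    (\<lambda>x\<in>residues s. \<lambda>i\<in>{1..t}. a x i \<otimes>\<^bsub>G i\<^esub> b ((x - h) mod int s) i, (h + k) mod int s)"
proof -
  have "h \<in> residues s" using assms by (simp add: carrier_W)
  then show ?thesis
    by (auto simp: W_def wreath_product_def semidirect_product_def translation_action_def
        fun_eq_iff mod_simps)
qed

lemma \<phi>_aut:
  assumes "i \<in> {1..t}" "g \<in> carrier (G i)"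
  shows "\<phi> i g \<in> extensional (U i)" "commuting_perm (U i) (q i) (\<phi> i g)"
  using iso[OF assms(1)] assms(2) by (auto simp: iso_def hom_def carrier_fun_Aut)

lemma \<phi>_mult:
  assumes "i \<in> {1..t}" "g \<in> carrier (G i)" "g' \<in> carrier (G i)"
  shows "\<phi> i (g \<otimes>\<^bsub>G i\<^esub> g') = compose (U i) (\<phi> i g) (\<phi> i g')"
proof -
  have h: "\<phi> i \<in> hom (G i) (fun_Aut (U i) (q i))" using iso[OF assms(1)] by (simp add: iso_def)
  then have "\<phi> i g \<in> carrier (fun_Aut (U i) (q i))" "\<phi> i g' \<in> carrier (fun_Aut (U i) (q i))"
    using assms by (auto simp: hom_def)
  then show ?thesis using h assms by (simp add: hom_mult mult_fun_Aut)
qed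

lemma realize_extensional: "realize x \<in> extensional points"
  by (cases x) (simp add: realize_def assemble_extensional)

lemma realize_pt:
  assumes "pt v (i, j) k \<in> points"
  shows "realize (a, h) (pt v (i, j) k) = pt (\<phi> i (a ((h + j) mod int s) i) v) (i, (h + j) mod int s) k"
  unfolding realize_def using assemble_pt[OF assms] by simp

lemma coordinate_mem:
  assumes "(a, h) \<in> carrier W" "i \<in> {1..t}" "x \<in> residues s"
  shows "a x i \<in> carrier (G i)"
  using assms by (auto simp: carrier_W PiE_iff)

lemma bij_betw_shift: "bij_betw (\<lambda>(i, j). (i, (h + j) mod int s)) blocks blocks"
  by (rule bij_betw_byWitness[where f' = "\<lambda>(i, j). (i, (j - h) mod int s)"])
     (auto simp: blocks_def residues_iff mod_simps)

lemma advance_shift: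
  assumes "b \<in> blocks"
  shows "(\<lambda>(i, j). (i, (h + j) mod int s)) (advance t s b) = advance t s ((\<lambda>(i, j). (i, (h + j) mod int s)) b)"
  using assms by (auto simp: blocks_def advance_def mod_simps) (simp add: add.assoc)

lemma realize_mem:
  assumes "(a, h) \<in> carrier W"
  shows "realize (a, h) \<in> carrier (fun_Aut points step)"
proof -
  let ?\<pi> = "\<lambda>(i :: nat, j). (i, (h + j) mod int s)"
  let ?\<alpha> = "\<lambda>(i, j). \<phi> i (a ((h + j) mod int s) i)"
  have \<alpha>: "commuting_perm (U (fst b)) (q (fst b)) (?\<alpha> b)" if "b \<in> blocks" for b
    using that \<phi>_aut(2)[OF _ coordinate_mem[OF assms]] by (auto simp: blocks_def)
  have "commuting_perm points step (assemble ?\<pi> ?\<alpha>)"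
  proof (rule assemble_automorphism)
    show "bij_betw ?\<pi> blocks blocks" by (rule bij_betw_shift)
    fix b assume b: "b \<in> blocks"
    show "?\<pi> (advance t s b) = advance t s (?\<pi> b)" by (rule advance_shift[OF b])
    show "?\<pi> b \<in> first_blocks \<longleftrightarrow> b \<in> first_blocks"
      using b by (auto simp: blocks_def first_blocks_def)
    show "bij_betw (?\<alpha> b) (U (fst b)) (U (fst (?\<pi> b)))"
      using \<alpha>[OF b] by (auto simp: commuting_perm_def split: prod.splits)
    show "?\<alpha> b (q (fst b) v) = q (fst (?\<pi> b)) (?\<alpha> b v)" if "v \<in> U (fst b)" for v
      using \<alpha>[OF b] that by (auto simp: commuting_perm_def split: prod.splits)
  qed
  then show ?thesis by (simp add: carrier_fun_Aut realize_def assemble_extensional)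
qed

lemma eq_on_points:
  assumes "\<sigma> \<in> extensional points" "\<tau> \<in> extensional points"
    and "\<And>v i j k. pt v (i, j) k \<in> points \<Longrightarrow> \<sigma> (pt v (i, j) k) = \<tau> (pt v (i, j) k)"
  shows "\<sigma> = \<tau>"
proof (rule extensionalityI[OF assms(1,2)])
  fix x assume x: "x \<in> points"
  obtain v b k where "x = pt v b k" using x by (rule points_cases)
  then show "\<sigma> x = \<tau> x" using assms(3) x by (cases b) simp
qed

lemma realize_mult:
  assumes x: "(a, h) \<in> carrier W" and y: "(b, k) \<in> carrier W"
  shows "realize ((a, h) \<otimes>\<^bsub>W\<^esub> (b, k)) = compose points (realize (a, h)) (realize (b, k))"
proof (rule eq_on_points)
  show "realize ((a, h) \<otimes>\<^bsub>W\<^esub> (b, k)) \<in> extensional points" by (rule realize_extensional)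
  show "compose points (realize (a, h)) (realize (b, k)) \<in> extensional points"
    by (simp add: compose_def)
  fix v i j l assume p: "pt v (i, j) l \<in> points"
  let ?x = "(h + k + j) mod int s" and ?y = "(k + j) mod int s"
  have i: "i \<in> {1..t}" and v: "v \<in> U i" using p by auto
  have "bij_betw (realize (b, k)) points points"
    using realize_mem[OF y] by (simp add: carrier_fun_Aut commuting_perm_def)
  then have p': "realize (b, k) (pt v (i, j) l) \<in> points" using p bij_betwE by blast
  have "realize ((a, h) \<otimes>\<^bsub>W\<^esub> (b, k)) (pt v (i, j) l)
      = pt (\<phi> i (a ?x i \<otimes>\<^bsub>G i\<^esub> b ?y i) v) (i, ?x) l"
    using i by (simp add: mult_W[OF x y] realize_pt[OF p] mod_simps algebra_simps)
  also have "\<phi> i (a ?x i \<otimes>\<^bsub>G i\<^esub> b ?y i) v = \<phi> i (a ?x i) (\<phi> i (b ?y i) v)"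
    using \<phi>_mult[OF i coordinate_mem[OF x i] coordinate_mem[OF y i]] v by (simp add: compose_eq)
  also have "pt \<dots> (i, ?x) l = realize (a, h) (realize (b, k) (pt v (i, j) l))"
    using p' by (simp add: realize_pt[OF p] realize_pt mod_simps ac_simps)
  finally show "realize ((a, h) \<otimes>\<^bsub>W\<^esub> (b, k)) (pt v (i, j) l)
      = compose points (realize (a, h)) (realize (b, k)) (pt v (i, j) l)"
    by (simp only: compose_eq[OF p])
qed

lemma inj_realize: "inj_on realize (carrier W)"
proof (rule inj_onI, clarify)
  fix a h b k assume x: "(a, h) \<in> carrier W" and y: "(b, k) \<in> carrier W"
    and eq: "realize (a, h) = realize (b, k)"
  have "0 \<in> residues s" by (simp add: residues_iff)
  then have p0: "root (1, 0) \<in> points"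
    using t root_mem_V[of "(1, 0)"] by simp
  have hk: "h = k"
    using fun_cong[OF eq, of "root (1, 0)"] p0 x y
    by (simp add: realize_pt carrier_W residues_iff del: pt_mem_points)
  have coordinates: "a x i = b x i" if xi: "x \<in> residues s" "i \<in> {1..t}" for x i
  proof -
    have g: "a x i \<in> carrier (G i)" "b x i \<in> carrier (G i)"
      using coordinate_mem x y xi by auto
    have "\<phi> i (a x i) v = \<phi> i (b x i) v" if v: "v \<in> U i" for v
    proof -
      have p: "pt v (i, (x - h) mod int s) False \<in> points" using v xi by simp
      have "(h + (x - h) mod int s) mod int s = x" using xi by (simp add: mod_simps residues_iff)
      then show ?thesis
        using fun_cong[OF eq, of "pt v (i, (x - h) mod int s) False"]
        unfolding realize_pt[OF p] hk[symmetric] by simp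
    qed
    then have "\<phi> i (a x i) = \<phi> i (b x i)"
      using \<phi>_aut(1)[OF xi(2)] g by (intro extensionalityI[of _ "U i"])
    then show ?thesis
      using iso[OF xi(2)] g by (auto simp: iso_def bij_betw_def inj_on_def)
  qed
  have ab: "a \<in> residues s \<rightarrow>\<^sub>E (\<Pi>\<^sub>E i\<in>{1..t}. carrier (G i))"
      "b \<in> residues s \<rightarrow>\<^sub>E (\<Pi>\<^sub>E i\<in>{1..t}. carrier (G i))"
    using x y by (simp_all only: carrier_W mem_Times_iff fst_conv)
  have "a = b"
  proof (rule PiE_ext[OF ab])
    fix u assume u: "u \<in> residues s"
    show "a u = b u"
      using coordinates[OF u] by (rule PiE_ext[OF PiE_mem[OF ab(1) u] PiE_mem[OF ab(2) u]])
  qed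
  then show "a = b \<and> h = k" using hk by simp
qed

text \<open>
  An automorphism shifts the blocks by some \<open>h\<close>; the tree automorphism found at the target block
  \<open>(i, x)\<close> comes from the source block \<open>(i, x - h)\<close>, and its preimage under \<open>\<phi> i\<close> is the coordinate.
\<close>

lemma surj_realize:
  assumes \<sigma>: "\<sigma> \<in> carrier (fun_Aut points step)"
  shows "\<sigma> \<in> realize ` carrier W"
proof -
  have ext: "\<sigma> \<in> extensional points" and comm: "commuting_perm points step \<sigma>"
    using \<sigma> by (auto simp: carrier_fun_Aut)
  obtain \<pi> \<alpha> where "\<And>b. b \<in> blocks \<Longrightarrow> \<pi> b \<in> blocks"
    and \<pi>: "\<And>b. b \<in> blocks \<Longrightarrow> \<pi> (advance t s b) = advance t s (\<pi> b)"
      "\<And>b. b \<in> first_blocks \<Longrightarrow> \<pi> b \<in> first_blocks"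
    and \<alpha>: "\<And>b. b \<in> blocks \<Longrightarrow> bij_betw (\<alpha> b) (U (fst b)) (U (fst (\<pi> b)))"
      "\<And>b v. b \<in> blocks \<Longrightarrow> v \<in> U (fst b) \<Longrightarrow> \<alpha> b (q (fst b) v) = q (fst (\<pi> b)) (\<alpha> b v)"
    and \<sigma>_pt: "\<And>v b k. pt v b k \<in> points \<Longrightarrow> \<sigma> (pt v b k) = pt (\<alpha> b v) (\<pi> b) k"
    by (rule automorphism_decompose[OF comm]) blast
  obtain h where h: "h \<in> residues s"
      "\<And>i j. i \<in> {1..t} \<Longrightarrow> j \<in> residues s \<Longrightarrow> \<pi> (i, j) = (i, (h + j) mod int s)"
    using advance_symmetry_is_shift[OF t, of s \<pi>] \<pi> unfolding blocks_def first_blocks_def by blast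
  define A where "A i j = restrict (\<alpha> (i, j)) (U i)" for i j
  have A: "A i j \<in> carrier (fun_Aut (U i) (q i))" if i: "i \<in> {1..t}" and j: "j \<in> residues s" for i j
  proof -
    have "bij_betw (\<alpha> (i, j)) (U i) (U i)" using \<alpha>(1)[of "(i, j)"] h(2)[OF i j] i j by simp
    then have "bij_betw (A i j) (U i) (U i)" by (simp add: A_def cong: bij_betw_cong)
    moreover have "A i j (q i v) = q i (A i j v)" if v: "v \<in> U i" for v
      using \<alpha>(2)[of "(i, j)" v] h(2)[OF i j] i j v rooted[OF i] by (auto simp: A_def rooted_map_def)
    ultimately show ?thesis by (simp add: carrier_fun_Aut commuting_perm_def A_def)
  qed
  have surj: "\<exists>g\<in>carrier (G i). \<phi> i g = A i j" if "i \<in> {1..t}" "j \<in> residues s" for i j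
  proof -
    have "A i j \<in> \<phi> i ` carrier (G i)"
      using iso[OF that(1)] A[OF that] by (simp add: iso_def bij_betw_def)
    then show ?thesis by (metis imageE)
  qed
  define a where "a = (\<lambda>x\<in>residues s. \<lambda>i\<in>{1..t}. SOME g. g \<in> carrier (G i) \<and> \<phi> i g = A i ((x - h) mod int s))"
  have a: "a x i \<in> carrier (G i) \<and> \<phi> i (a x i) = A i ((x - h) mod int s)"
    if xi: "x \<in> residues s" "i \<in> {1..t}" for x i
    using someI_ex[of "\<lambda>g. g \<in> carrier (G i) \<and> \<phi> i g = A i ((x - h) mod int s)"]
      surj[OF xi(2) mod_residues] xi by (auto simp: a_def)
  have W: "(a, h) \<in> carrier W"
    using a h(1) by (auto simp: carrier_W PiE_iff a_def)
  have "realize (a, h) = \<sigma>"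
  proof (rule eq_on_points[OF _ ext])
    show "realize (a, h) \<in> extensional points" by (rule realize_extensional)
    fix v i j k assume p: "pt v (i, j) k \<in> points"
    then have i: "i \<in> {1..t}" and j: "j \<in> residues s" and v: "v \<in> U i" by auto
    have "((h + j) mod int s - h) mod int s = j" using j by (simp add: mod_simps residues_iff)
    then have "\<phi> i (a ((h + j) mod int s) i) v = \<alpha> (i, j) v"
      using a[OF mod_residues i, of "h + j"] v by (simp add: A_def)
    then show "realize (a, h) (pt v (i, j) k) = \<sigma> (pt v (i, j) k)"
      by (simp add: realize_pt[OF p] \<sigma>_pt[OF p] h(2)[OF i j])
  qed
  then show ?thesis using W by blast
qed

theorem wreath_product_iso_automorphisms: "W \<cong> fun_Aut points step"
proof -
  have "realize \<in> hom W (fun_Aut points step)"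
  proof (rule homI)
    fix x y assume x: "x \<in> carrier W" and y: "y \<in> carrier W"
    show "realize x \<in> carrier (fun_Aut points step)"
      using realize_mem x by (cases x) auto
    show "realize (x \<otimes>\<^bsub>W\<^esub> y) = realize x \<otimes>\<^bsub>fun_Aut points step\<^esub> realize y"
      using realize_mult realize_mem x y by (cases x; cases y) (simp add: mult_fun_Aut)
  qed
  moreover have "realize ` carrier W = carrier (fun_Aut points step)"
    using realize_mem surj_realize by auto
  ultimately show ?thesis
    using inj_realize by (auto simp: is_iso_def iso_def bij_betw_def)
qed

lemma connected_step_necklace: "connected_fun points step"
proof (rule connected_step)
  show "connected_fun blocks (advance t s)"
    unfolding blocks_def by (rule connected_advance[OF t])
qed

lemma cyclic_orbit_iff:
  assumes s: "s \<ge> 1"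
  shows "cyclic_orbit points step C \<longleftrightarrow> C = root ` blocks"
proof (rule cyclic_orbit_step_iff[where ?b0.0 = "(1, 0)" and ?n0.0 = "t * s"])
  show "forward_orbit (advance t s) b = blocks" if "b \<in> blocks" for b
    using forward_orbit_advance_finite[OF t s that[unfolded blocks_def]] by (simp add: blocks_def)
  have "0 \<in> residues s" by (simp add: residues_iff)
  then show "(advance t s ^^ (t * s)) (1, 0) = (1, 0)" "(1, 0) \<in> blocks"
    using funpow_advance_round[OF t, of 0 s s] t by auto
  show "t * s > 0" using t s by simp
qed

lemma card_roots: "s \<ge> 1 \<Longrightarrow> card (root ` blocks) = s * t"
proof -
  assume "s \<ge> 1"
  have "inj_on root blocks" by (rule inj_onI) simp
  then have "card (root ` blocks) = card blocks" by (rule card_image)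
  then show ?thesis
    using \<open>s \<ge> 1\<close> by (simp add: blocks_def card_cartesian_product carrier_integer_mod_group)
qed

lemma finite_orbit:
  assumes s: "s \<ge> 1"
  shows "\<exists>x\<in>points. finite (forward_orbit step x)"
proof -
  have b: "(1, 0) \<in> blocks" using t by (simp add: residues_iff)
  have "finite (forward_orbit step (root (1, 0)))"
    unfolding forward_orbit_root forward_orbit_advance_finite[OF t s b[unfolded blocks_def]]
    using s by (simp add: carrier_integer_mod_group)
  moreover have "root (1, 0) \<in> points" using b root_mem_V[OF b] by simp
  ultimately show ?thesis by blast
qed

text \<open>
  In the infinite necklace the shift by \<open>1\<close> moves every block.
\<close>

lemma fixpoint_free_automorphism:
  assumes s: "s = 0" and grp: "\<And>i. i \<in> {1..t} \<Longrightarrow> group (G i)"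
  shows "\<exists>\<sigma>\<in>carrier (fun_Aut points step). \<forall>x\<in>points. \<sigma> x \<noteq> x"
proof -
  let ?a = "\<lambda>x\<in>residues s. \<lambda>i\<in>{1..t}. \<one>\<^bsub>G i\<^esub>"
  have "\<one>\<^bsub>G i\<^esub> \<in> carrier (G i)" if "i \<in> {1..t}" for i
    using monoid.one_closed[OF group.is_monoid[OF grp[OF that]]] .
  moreover have "1 \<in> residues s" using s by (simp add: residues_iff)
  ultimately have "(?a, 1) \<in> carrier W" by (auto simp: carrier_W)
  then have "realize (?a, 1) \<in> carrier (fun_Aut points step)" by (rule realize_mem)
  moreover have "realize (?a, 1) x \<noteq> x" if x: "x \<in> points" for x
  proof -
    obtain v b k where "x = pt v b k" using x by (rule points_cases)
    then obtain i j where xv: "x = pt v (i, j) k" by (cases b) blast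
    have "(1 + j) mod int s \<noteq> j" using s by simp
    then show ?thesis using realize_pt[OF x[unfolded xv]] unfolding xv by simp
  qed
  ultimately show ?thesis by blast
qed

end

section \<open>Realisation of the wreath products\<close>

theorem theorem4p15:
  fixes G :: "nat \<Rightarrow> 'g monoid" and t :: nat
  assumes "t \<ge> 1"
    and "\<And>i. i \<in> {1..t} \<Longrightarrow> group (G i)"
    and "\<And>i. i \<in> {1..t} \<Longrightarrow>
           \<exists>(T :: 'v pair_pre_digraph) r. directed_rooted_tree T r \<and> G i \<cong> digraph_Aut T"
  shows "(\<forall>s::nat. s \<ge> 1 \<longrightarrow>
            (\<exists>(X :: ('v \<times> nat) set) f. f \<in> X \<rightarrow> X \<and> connected_fun X f \<and>
               (\<exists>x\<in>X. finite (forward_orbit f x)) \<and>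
               (\<exists>!C. cyclic_orbit X f C) \<and>
               (\<forall>C. cyclic_orbit X f C \<longrightarrow> card C = s * t) \<and>
               wreath_product (product_group {1..t} G) (integer_mod_group s)
                 (carrier (integer_mod_group s)) (translation_action (integer_mod_group s))
               \<cong> fun_Aut X f))
       \<and> (\<exists>(X :: ('v \<times> nat) set) f. f \<in> X \<rightarrow> X \<and> connected_fun X f \<and>
               (\<forall>x\<in>X. infinite (forward_orbit f x)) \<and>
               (\<exists>\<sigma>\<in>carrier (fun_Aut X f). \<forall>x\<in>X. \<sigma> x \<noteq> x) \<and>
               wreath_product (product_group {1..t} G) integer_group
                 (carrier integer_group) (translation_action integer_group)
               \<cong> fun_Aut X f)"
proof -
  have "\<exists>V p r \<phi>. rooted_map V p r \<and> \<phi> \<in> iso (G i) (fun_Aut (V :: 'v set) p)" if i: "i \<in> {1..t}" for i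
  proof -
    obtain T :: "'v pair_pre_digraph" and r where T: "directed_rooted_tree T r" "G i \<cong> digraph_Aut T"
      using assms(3)[OF i] by blast
    obtain p where p: "rooted_map (pverts T) p r"
      "\<And>u v. u \<in> pverts T \<Longrightarrow> v \<in> pverts T \<Longrightarrow> (u, v) \<in> parcs T \<longleftrightarrow> u \<noteq> r \<and> v = p u"
      using directed_rooted_tree_parent_map[OF T(1)] by blast
    have "G i \<cong> fun_Aut (pverts T) p" using T(2) digraph_Aut_eq_fun_Aut[OF p] by simp
    then show ?thesis using p(1) unfolding is_iso_def by blast
  qed
  then obtain V :: "nat \<Rightarrow> 'v set" and p r \<phi> where trees:
      "\<And>i. i \<in> {1..t} \<Longrightarrow> rooted_map (V i) (p i) (r i)"
      "\<And>i. i \<in> {1..t} \<Longrightarrow> \<phi> i \<in> iso (G i) (fun_Aut (V i) (p i))"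
    by metis
  then have necklace: "tree_necklace t V p r G \<phi>"
    using assms(1) by unfold_locales
  show ?thesis
  proof (intro conjI allI impI)
    fix s :: nat
    assume s: "s \<ge> 1"
    interpret tree_necklace t s V p r G \<phi> by (rule necklace)
    show "\<exists>(X :: ('v \<times> nat) set) f. f \<in> X \<rightarrow> X \<and> connected_fun X f \<and>
               (\<exists>x\<in>X. finite (forward_orbit f x)) \<and>
               (\<exists>!C. cyclic_orbit X f C) \<and>
               (\<forall>C. cyclic_orbit X f C \<longrightarrow> card C = s * t) \<and>
               wreath_product (product_group {1..t} G) (integer_mod_group s)
                 (carrier (integer_mod_group s)) (translation_action (integer_mod_group s))
               \<cong> fun_Aut X f"
    proof (intro exI[of _ points] exI[of _ step] conjI step_points connected_step_necklace
          finite_orbit[OF s] wreath_product_iso_automorphisms[unfolded W_def])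
      show "\<exists>!C. cyclic_orbit points step C"
        unfolding cyclic_orbit_iff[OF s] by blast
      show "\<forall>C. cyclic_orbit points step C \<longrightarrow> card C = s * t"
        unfolding cyclic_orbit_iff[OF s] using card_roots[OF s] by blast
    qed
  next
    interpret tree_necklace t 0 V p r G \<phi> by (rule necklace)
    have integers: "integer_mod_group 0 = integer_group" by (simp add: integer_mod_group_def)
    have orbits: "\<forall>x\<in>points. infinite (forward_orbit step x)"
    proof
      fix x assume "x \<in> points"
      then show "infinite (forward_orbit step x)"
      proof (rule infinite_forward_orbit_step[rotated])
        show "infinite (forward_orbit (advance t 0) b)" if "b \<in> blocks" for b
          using forward_orbit_advance_infinite[OF assms(1)] that unfolding blocks_def by blast
      qed
    qed
    show "\<exists>(X :: ('v \<times> nat) set) f. f \<in> X \<rightarrow> X \<and> connected_fun X f \<and>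
               (\<forall>x\<in>X. infinite (forward_orbit f x)) \<and>
               (\<exists>\<sigma>\<in>carrier (fun_Aut X f). \<forall>x\<in>X. \<sigma> x \<noteq> x) \<and>
               wreath_product (product_group {1..t} G) integer_group
                 (carrier integer_group) (translation_action integer_group)
               \<cong> fun_Aut X f"
      by (intro exI[of _ points] exI[of _ step] conjI step_points connected_step_necklace orbits
          fixpoint_free_automorphism[OF refl assms(2)]
          wreath_product_iso_automorphisms[unfolded W_def integers])
  qed
qed

end
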